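(* Let $G=(V,E)$ be an $\mathcal{M}_{2,2}^*$-circuit distinct from $K_5-e$ and $H_1$. Then $G$ has either a $K_4^-$-reduction or an admissible edge-reduction.
   Context: All graphs are finite and simple. A graph $G=(V,E)$ is an $\mathcal{M}_{2,2}^*$-circuit if $|E|=2|V|-1$ and every nonempty proper subset $F\subsetneq E$ satisfies $|F|\le 2|V(F)|-2$, where $V(F)$ is the set of vertices incident with $F$. $K_5-e$ is $K_5$ minus one edge; $H_1$ is two copies of $K_4$ sharing exactly one edge. A $K_4^-$-reduction of $G$ is the inverse of a $K_4^-$-extension: if $G$ has two adjacent vertices $u_1,u_2$ of degree $3$ with common neighbours $x,y$ (so $N(u_1)=\{u_2,x,y\}$, $N(u_2)=\{u_1,x,y\}$) and $xy\notin E$, delete $u_1,u_2$ and add the edge $xy$. An edge-reduction of $G$ (the inverse of a generalised vertex split) chooses two distinct edges $e=ux$ and $f=uw$ sharing an endpoint $u$ (with $x\ne w$), deletes $e$ and then contracts $f$ (identifies $u$ and $w$ into a single vertex and deletes the resulting loop, keeping all other edges with multiplicity); it is admissible if the resulting multigraph is a simple graph which is an $\mathcal{M}_{2,2}^*$-circuit. *)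

theory Defs
  imports Main "HOL-Library.Multiset"
begin

type_synonym 'a graph = "'a set \<times> 'a set set"

abbreviation verts :: "'a graph \<Rightarrow> 'a set" where
  "verts G \<equiv> fst G"

abbreviation edges :: "'a graph \<Rightarrow> 'a set set" where
  "edges G \<equiv> snd G"

definition simple_graph :: "'a graph \<Rightarrow> bool" where
  "simple_graph G \<longleftrightarrow> finite (verts G) \<and> (\<forall>e \<in> edges G. e \<subseteq> verts G \<and> card e = 2)"

definition neighbours :: "'a graph \<Rightarrow> 'a \<Rightarrow> 'a set" where
  "neighbours G v = {w. {v, w} \<in> edges G}"

definition degree :: "'a graph \<Rightarrow> 'a \<Rightarrow> nat" where
  "degree G v = card {e \<in> edges G. v \<in> e}"

definition isomorphic :: "'a graph \<Rightarrow> 'b graph \<Rightarrow> bool" where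
  "isomorphic G H \<longleftrightarrow>
     (\<exists>f. bij_betw f (verts G) (verts H) \<and> (\<lambda>e. f ` e) ` edges G = edges H)"

text \<open>The vertex set \<open>V(F)\<close> of an edge set \<open>F\<close> is \<open>\<Union>F\<close>. The counts are taken in the
  integers so that the subtractions do not truncate.\<close>

definition M22_circuit :: "'a graph \<Rightarrow> bool" where
  "M22_circuit G \<longleftrightarrow> simple_graph G \<and>
     int (card (edges G)) = 2 * int (card (verts G)) - 1 \<and>
     (\<forall>F. F \<subset> edges G \<and> F \<noteq> {} \<longrightarrow> int (card F) \<le> 2 * int (card (\<Union>F)) - 2)"

definition complete_edges :: "'a set \<Rightarrow> 'a set set" where
  "complete_edges S = {e. e \<subseteq> S \<and> card e = 2}"

definition K5_minus_e :: "nat graph" where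
  "K5_minus_e = ({0, 1, 2, 3, 4}, complete_edges {0, 1, 2, 3, 4} - {{0, 1}})"

text \<open>The two copies of \<open>K\<^sub>4\<close> share the edge \<open>{0, 1}\<close>.\<close>

definition H1 :: "nat graph" where
  "H1 = ({0, 1, 2, 3, 4, 5}, complete_edges {0, 1, 2, 3} \<union> complete_edges {0, 1, 4, 5})"

definition K4_minus_reduction :: "'a graph \<Rightarrow> 'a graph \<Rightarrow> bool" where
  "K4_minus_reduction G H \<longleftrightarrow>
     (\<exists>u1 u2 x y. {u1, u2} \<in> edges G \<and> degree G u1 = 3 \<and> degree G u2 = 3 \<and>
        neighbours G u1 = {u2, x, y} \<and> neighbours G u2 = {u1, x, y} \<and>
        {x, y} \<notin> edges G \<and>
        H = (verts G - {u1, u2}, {e \<in> edges G. u1 \<notin> e \<and> u2 \<notin> e} \<union> {{x, y}}))"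

text \<open>In a multigraph, a loop at \<open>v\<close> is represented by the singleton \<open>{v}\<close>.\<close>

type_synonym 'a multigraph = "'a set \<times> 'a set multiset"

definition multigraph_of :: "'a graph \<Rightarrow> 'a multigraph" where
  "multigraph_of G = (verts G, mset_set (edges G))"

definition delete_edge :: "'a set \<Rightarrow> 'a multigraph \<Rightarrow> 'a multigraph" where
  "delete_edge e M = (fst M, snd M - {#e#})"

text \<open>Contraction of one edge \<open>{u, w}\<close>: \<open>w\<close> is identified with \<open>u\<close>, the new vertex keeps the
  name \<open>u\<close>, and the single loop \<open>{u}\<close> that arises from the contracted edge is removed. All other
  edges are kept with their multiplicity, so edges to common neighbours of \<open>u\<close> and \<open>w\<close> become
  parallel.\<close>

definition contract_edge :: "'a \<Rightarrow> 'a \<Rightarrow> 'a multigraph \<Rightarrow> 'a multigraph" where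
  "contract_edge u w M =
     (let \<phi> = (\<lambda>v. if v = w then u else v)
      in (\<phi> ` fst M, image_mset (\<lambda>e. \<phi> ` e) (snd M) - {#{u}#}))"

definition edge_reduction :: "'a graph \<Rightarrow> 'a multigraph \<Rightarrow> bool" where
  "edge_reduction G M \<longleftrightarrow>
     (\<exists>u x w. {u, x} \<in> edges G \<and> {u, w} \<in> edges G \<and> x \<noteq> w \<and>
        M = contract_edge u w (delete_edge {u, x} (multigraph_of G)))"

text \<open>A multigraph of the form \<open>multigraph_of H\<close> with \<open>H\<close> a simple graph is one without loops and
  parallel edges; simplicity of \<open>H\<close> is part of \<open>M22_circuit\<close>.\<close>

definition admissible_edge_reduction :: "'a graph \<Rightarrow> 'a multigraph \<Rightarrow> bool" where
  "admissible_edge_reduction G M \<longleftrightarrow>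
     edge_reduction G M \<and> (\<exists>H. M = multigraph_of H \<and> M22_circuit H)"

end

theory Submission
  imports Defs
begin

text \<open>
  Give a vertex set \<open>S\<close> the slack \<open>2|S| - 2\<close> minus the number of edges inside \<open>S\<close>. In a circuit the
  slack is nonnegative on nonempty proper vertex sets, it is \<open>-1\<close> on \<open>V\<close>, and it is modular up to
  the edges crossing between two sets. Deleting \<open>ux\<close> and contracting \<open>uw\<close> fails to be admissible only
  if \<open>u\<close>, \<open>w\<close> have a common neighbour other than \<open>x\<close>, or some tight set (slack \<open>0\<close>) contains \<open>u\<close> and
  \<open>w\<close> but not \<open>x\<close>.

  Suppose no reduction exists. If some tight set with at least two vertices misses a vertex of degree
  at least 4, take one whose complement \<open>D\<close> is minimal. Vertices of degree 3 induce a forest; playing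
  the blocking tight sets at a leaf or isolated vertex of the part of this forest in \<open>D\<close> against each
  other shows that every degree 3 vertex of \<open>D\<close> lies with all its neighbours in a \<open>K\<^sub>4\<close> inside \<open>D\<close>.
  A degree count over the maximal tight proper subsets of \<open>D\<close> then forces \<open>D\<close> itself to be such a
  \<open>K\<^sub>4\<close>, where a reduction along one of the three edges leaving \<open>D\<close> is admissible. If there is no such
  \<open>D\<close>, the same leaf argument in \<open>V\<close> shows that two copies of \<open>K\<^sub>4\<close> cover the graph, which leaves only
  \<open>K\<^sub>5 - e\<close> and \<open>H\<^sub>1\<close>.
\<close>

section \<open>Sparsity counts\<close>

locale circuit =
  fixes V :: "'a set" and E :: "'a set set"
  assumes circ: "M22_circuit (V, E)"
begin

definition nb :: "'a \<Rightarrow> 'a set" where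
  "nb v = {w. {v, w} \<in> E}"

definition edges_in :: "'a set \<Rightarrow> int" where
  "edges_in S = int (card {e \<in> E. e \<subseteq> S})"

text \<open>The extreme values are \<open>-2\<close> for the empty set, \<open>0\<close> for a
  singleton and \<open>-1\<close> for \<open>V\<close>, so nonnegativity is confined to nonempty
  proper subsets.\<close>

definition slack :: "'a set \<Rightarrow> int" where
  "slack S = 2 * int (card S) - 2 - edges_in S"

text \<open>These are exactly the edges inside \<open>A \<union> B\<close> that lie in neither
  \<open>A\<close> nor \<open>B\<close>: the error term in \<open>slack_modular\<close>.\<close>

definition cross :: "'a set \<Rightarrow> 'a set \<Rightarrow> 'a set set" where
  "cross A B = {e \<in> E. \<exists>p\<in>A - B. \<exists>q\<in>B - A. e = {p, q}}"

text \<open>Singletons are tight on purpose: they make the maximal tight proper subsets of a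
  fragment cover it. Arguments about larger tight sets ask for
  \<open>2 \<le> card Z\<close>.\<close>

definition tight :: "'a set \<Rightarrow> bool" where
  "tight Z \<longleftrightarrow> Z \<subseteq> V \<and> Z \<noteq> {} \<and> slack Z = 0"

definition cubic :: "'a set" where
  "cubic = {v \<in> V. card (nb v) = 3}"

definition clique :: "'a set \<Rightarrow> bool" where
  "clique K \<longleftrightarrow> (\<forall>p\<in>K. \<forall>q\<in>K. p \<noteq> q \<longrightarrow> q \<in> nb p)"

lemma finite_V: "finite V"
  using circ by (simp add: M22_circuit_def simple_graph_def)

lemma edge_subset: "e \<in> E \<Longrightarrow> e \<subseteq> V"
  and edge_card: "e \<in> E \<Longrightarrow> card e = 2"
  using circ by (auto simp: M22_circuit_def simple_graph_def)

lemma finite_E: "finite E"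
  by (rule finite_subset[of _ "Pow V"]) (use edge_subset finite_V in auto)

lemma card_E: "int (card E) = 2 * int (card V) - 1"
  using circ by (simp add: M22_circuit_def)

lemma sparse: "F \<subset> E \<Longrightarrow> F \<noteq> {} \<Longrightarrow> int (card F) \<le> 2 * int (card (\<Union>F)) - 2"
  using circ by (auto simp: M22_circuit_def)

lemma finite_sub: "S \<subseteq> V \<Longrightarrow> finite S"
  using finite_V finite_subset by blast

lemma nb_iff: "w \<in> nb v \<longleftrightarrow> {v, w} \<in> E"
  by (simp add: nb_def)

lemma nb_sym: "w \<in> nb v \<longleftrightarrow> v \<in> nb w"
  by (simp add: nb_def insert_commute)

lemma nb_symD: "w \<in> nb v \<Longrightarrow> v \<in> nb w"
  by (simp add: nb_def insert_commute)

lemma nb_subset: "nb v \<subseteq> V"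
  using edge_subset by (auto simp: nb_def)

lemma nb_irrefl [simp]: "v \<notin> nb v"
  using edge_card[of "{v}"] by (auto simp: nb_def)

lemma finite_nb [simp]: "finite (nb v)"
  using finite_sub[OF nb_subset] .

lemma edge_cases:
  assumes "e \<in> E"
  obtains p q where "e = {p, q}" "p \<noteq> q" "q \<in> nb p" "p \<in> V" "q \<in> V"
proof -
  obtain p q where e: "e = {p, q}" "p \<noteq> q"
    using edge_card[OF assms] by (auto simp: card_2_iff)
  show thesis
    by (rule that[of p q]) (use e assms edge_subset[OF assms] in \<open>auto simp: nb_def\<close>)
qed

lemma degree_eq: "degree (V, E) v = card (nb v)"
proof -
  have "{e \<in> E. v \<in> e} = (\<lambda>w. {v, w}) ` nb v"
  proof (intro equalityI subsetI)
    fix e assume e: "e \<in> {e \<in> E. v \<in> e}"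
    then obtain p q where "e = {p, q}" by (auto elim: edge_cases)
    then have "e = {v, if v = p then q else p}" using e by auto
    then show "e \<in> (\<lambda>w. {v, w}) ` nb v" using e by (auto simp: nb_def)
  qed (auto simp: nb_def)
  moreover have "inj_on (\<lambda>w. {v, w}) (nb v)"
    by (auto simp: inj_on_def doubleton_eq_iff)
  ultimately show ?thesis
    by (simp add: degree_def card_image)
qed

lemma neighbours_eq: "neighbours (V, E) v = nb v"
  by (simp add: neighbours_def nb_def)

lemma edges_in_empty [simp]: "edges_in {} = 0"
proof -
  have "e \<noteq> {}" if "e \<in> E" for e using edge_card[OF that] by auto
  then have "{e \<in> E. e \<subseteq> {}} = {}" by auto
  then show ?thesis unfolding edges_in_def by simp
qed

lemma edges_in_insert:
  assumes "v \<notin> S"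
  shows "edges_in (insert v S) = edges_in S + int (card (nb v \<inter> S))"
proof -
  have "{e \<in> E. e \<subseteq> insert v S} = {e \<in> E. e \<subseteq> S} \<union> (\<lambda>w. {v, w}) ` (nb v \<inter> S)"
    (is "_ = ?A \<union> ?B")
  proof (intro equalityI subsetI)
    fix e assume e: "e \<in> {e \<in> E. e \<subseteq> insert v S}"
    then obtain p q where pq: "e = {p, q}" "p \<noteq> q" "q \<in> nb p"
      by (auto elim: edge_cases)
    show "e \<in> ?A \<union> ?B"
    proof (cases "v \<in> e")
      case True
      then have "p = v \<or> q = v" using pq by auto
      then show ?thesis
      proof
        assume "p = v" then show ?thesis using pq e by auto
      next
        assume "q = v"
        then have "e = {v, p}" "p \<in> nb v \<inter> S" using pq e nb_sym by auto
        then show ?thesis by blast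
      qed
    qed (use e in auto)
  qed (auto simp: nb_def)
  moreover have "card (?A \<union> ?B) = card ?A + card ?B"
    by (rule card_Un_disjoint) (use assms finite_E in auto)
  moreover have "card ?B = card (nb v \<inter> S)"
    by (rule card_image) (auto simp: inj_on_def doubleton_eq_iff)
  ultimately show ?thesis by (simp add: edges_in_def)
qed

lemma slack_insert: "finite S \<Longrightarrow> v \<notin> S \<Longrightarrow> slack (insert v S) = slack S + 2 - int (card (nb v \<inter> S))"
  by (simp add: slack_def edges_in_insert)

lemma slack_remove:
  assumes "finite S" "v \<in> S"
  shows "slack (S - {v}) = slack S - 2 + int (card (nb v \<inter> S))"
proof -
  have "nb v \<inter> (S - {v}) = nb v \<inter> S" by auto
  then show ?thesis
    using slack_insert[of "S - {v}" v] assms by (simp add: insert_absorb)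
qed

lemma finite_cross: "finite (cross A B)"
  using finite_E by (auto simp: cross_def)

lemma slack_modular:
  assumes "finite A" "finite B"
  shows "slack A + slack B = slack (A \<union> B) + slack (A \<inter> B) + int (card (cross A B))"
proof -
  let ?I = "\<lambda>S. {e \<in> E. e \<subseteq> S}"
  have U: "?I (A \<union> B) = (?I A \<union> ?I B) \<union> cross A B"
  proof (intro equalityI subsetI)
    fix e assume e: "e \<in> ?I (A \<union> B)"
    then obtain p q where pq: "e = {p, q}" by (auto elim: edge_cases)
    then show "e \<in> (?I A \<union> ?I B) \<union> cross A B"
      using e by (auto simp: cross_def)
  qed (auto simp: cross_def)
  have fin: "finite (?I S)" for S using finite_E by simp
  have "card (?I (A \<union> B)) = card (?I A \<union> ?I B) + card (cross A B)"
    unfolding U by (rule card_Un_disjoint) (use fin finite_cross in \<open>auto simp: cross_def\<close>)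
  moreover have "card (?I A) + card (?I B) = card (?I A \<union> ?I B) + card (?I A \<inter> ?I B)"
    by (rule card_Un_Int) (use fin in auto)
  moreover have "?I A \<inter> ?I B = ?I (A \<inter> B)" by auto
  moreover have "card A + card B = card (A \<union> B) + card (A \<inter> B)"
    by (rule card_Un_Int) (use assms in auto)
  ultimately show ?thesis by (simp add: slack_def edges_in_def)
qed

lemma edges_in_V: "edges_in V = int (card E)"
proof -
  have "{e \<in> E. e \<subseteq> V} = E" using edge_subset by auto
  then show ?thesis by (simp add: edges_in_def)
qed

lemma slack_V: "slack V = -1"
  by (simp add: slack_def edges_in_V card_E)

lemma card_V_ge_2: "2 \<le> card V"
proof (rule ccontr)
  assume "\<not> 2 \<le> card V"
  then have V: "card V \<le> 1" by simp
  have "E = {}"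
  proof (rule ccontr)
    assume "E \<noteq> {}"
    then obtain e where "e \<in> E" by auto
    then have "card e \<le> card V" "card e = 2"
      using edge_card card_mono[OF finite_V edge_subset] by auto
    then show False using V by simp
  qed
  then show False using card_E by simp presburger
qed

section \<open>Nonnegative slack and minimum degree\<close>

lemma slack_nonneg:
  assumes S: "S \<subset> V" "S \<noteq> {}"
  shows "0 \<le> slack S"
proof -
  let ?F = "{e \<in> E. e \<subseteq> S}"
  have fS: "finite S" using S finite_sub by auto
  have S1: "1 \<le> card S" using S fS by (simp add: Suc_leI card_gt_0_iff)
  have lt: "card S < card V" using S finite_V by (simp add: psubset_card_mono)
  show ?thesis
  proof (cases "?F = {}")
    case True then show ?thesis using S1 unfolding slack_def edges_in_def True by simp
  next
    case False
    \<comment> \<open>Sparsity speaks of proper edge subsets. If all edges lay in \<open>S\<close>,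
      deleting one would leave \<open>2|V| - 2\<close> edges on fewer than \<open>|V|\<close>
      vertices.\<close>
    have "?F \<noteq> E"
    proof
      assume FE: "?F = E"
      obtain e where e: "e \<in> E" using False by auto
      have c: "int (card (E - {e})) = 2 * int (card V) - 2"
        using card_E card_Suc_Diff1[OF finite_E e] by linarith
      have "E - {e} \<noteq> {}"
      proof
        assume "E - {e} = {}"
        then show False using c card_V_ge_2 by (simp only: card.empty)
      qed
      then have "int (card (E - {e})) \<le> 2 * int (card (\<Union>(E - {e}))) - 2"
        using e by (intro sparse) auto
      moreover have "card (\<Union>(E - {e})) \<le> card S"
        using FE fS by (intro card_mono) auto
      ultimately show False using c lt by simp
    qed
    then have "?F \<subset> E" by auto
    then have "int (card ?F) \<le> 2 * int (card (\<Union>?F)) - 2" using False by (rule sparse)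
    moreover have "card (\<Union>?F) \<le> card S" using fS by (intro card_mono) auto
    ultimately show ?thesis by (simp add: slack_def edges_in_def)
  qed
qed

text \<open>Deleting \<open>v\<close> from \<open>V\<close> changes the slack from \<open>-1\<close>
  to \<open>card (nb v) - 3\<close>, and the result must be nonnegative.\<close>

lemma card_nb_ge_3:
  assumes "v \<in> V" shows "3 \<le> card (nb v)"
proof -
  have "card (V - {v}) \<noteq> 0"
    using card_V_ge_2 assms by simp
  then have "V - {v} \<noteq> {}" by force
  then have "0 \<le> slack (V - {v})" using assms by (intro slack_nonneg) auto
  moreover have "nb v \<inter> V = nb v" using nb_subset by auto
  ultimately show ?thesis using slack_remove[OF finite_V assms] slack_V by simp
qed

lemma not_cubic: "v \<in> V \<Longrightarrow> v \<notin> cubic \<Longrightarrow> 4 \<le> card (nb v)"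
  using card_nb_ge_3[of v] by (auto simp: cubic_def)

lemma tight_remove_cubic:
  assumes "v \<in> V"
  shows "tight (V - {v}) \<longleftrightarrow> v \<in> cubic"
proof -
  have "card (V - {v}) \<noteq> 0"
    using card_V_ge_2 assms by simp
  then have "V - {v} \<noteq> {}" by force
  moreover have "nb v \<inter> V = nb v" using nb_subset by auto
  ultimately show ?thesis using slack_remove[OF finite_V assms] slack_V assms by (auto simp: tight_def cubic_def)
qed

text \<open>Edges inside \<open>S\<close> count twice and edges from \<open>S\<close> to
  \<open>C - S\<close> once; the edges of \<open>C\<close> meeting \<open>S\<close> number
  \<open>edges_in C - edges_in (C - S)\<close>.\<close>

lemma sum_nb:
  assumes "S \<subseteq> C" "C \<subseteq> V"
  shows "(\<Sum>v\<in>S. int (card (nb v \<inter> C))) = edges_in S + edges_in C - edges_in (C - S)"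
proof -
  have "finite S" using assms finite_sub by blast
  then show ?thesis using assms(1)
  proof (induction S rule: finite_induct)
    case empty
    show ?case by simp
  next
    case (insert v S)
    have fC: "finite C" using assms finite_sub by blast
    have "nb v \<inter> C = (nb v \<inter> S) \<union> (nb v \<inter> (C - insert v S))" using insert.prems by auto
    then have "card (nb v \<inter> C) = card (nb v \<inter> S) + card (nb v \<inter> (C - insert v S))"
      using card_Un_disjoint[of "nb v \<inter> S" "nb v \<inter> (C - insert v S)"] by fastforce
    moreover have "edges_in (C - S) = edges_in (C - insert v S) + int (card (nb v \<inter> (C - insert v S)))"
      using edges_in_insert[of v "C - insert v S"] insert by (metis Diff_iff Diff_insert insertCI insert_Diff insert_subset)
    ultimately show ?case using insert edges_in_insert[of v S] by simp
  qed
qed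

text \<open>The double count for \<open>C = V\<close>, with the edges avoiding \<open>S\<close>
  expressed through the slack of the complement.\<close>

lemma sum_degrees:
  assumes "S \<subseteq> V"
  shows "(\<Sum>v\<in>S. int (card (nb v))) = edges_in S + 2 * int (card S) + 1 + slack (V - S)"
proof -
  have "nb v \<inter> V = nb v" for v using nb_subset by auto
  moreover have "int (card (V - S)) = int (card V) - int (card S)"
    using assms finite_V by (simp add: card_Diff_subset card_mono finite_sub of_nat_diff)
  ultimately show ?thesis using sum_nb[OF assms order_refl] edges_in_V card_E by (simp add: slack_def)
qed

lemma sum_nb_bound:
  assumes "S \<subseteq> V"
  shows "2 * edges_in S \<le> int (card S) * (int (card S) - 1)"
proof -
  have "card (nb v \<inter> S) \<le> card S - 1" if "v \<in> S" for v
  proof -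
    have "card (nb v \<inter> S) \<le> card (S - {v})"
      by (rule card_mono) (use assms finite_sub in auto)
    then show ?thesis using that by simp
  qed
  moreover have "0 < card S" if "v \<in> S" for v
    using that finite_sub[OF assms] by (auto simp: card_gt_0_iff)
  ultimately have "int (card (nb v \<inter> S)) \<le> int (card S) - 1" if "v \<in> S" for v
    using that by fastforce
  then have "(\<Sum>v\<in>S. int (card (nb v \<inter> S))) \<le> int (card S) * (int (card S) - 1)"
    by (rule sum_bounded_above)
  then show ?thesis using sum_nb[of S S] assms by simp
qed

section \<open>Tight sets\<close>

lemma tight_card:
  assumes "tight Z" "2 \<le> card Z"
  shows "4 \<le> card Z"
proof (rule ccontr)
  assume "\<not> 4 \<le> card Z"
  then have "card Z = 2 \<or> card Z = 3" using assms by auto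
  \<comment> \<open>Two or three vertices span at most 1 or 3 edges, fewer than the 2 or 4 that
    tightness demands.\<close>
  then show False using sum_nb_bound[of Z] assms by (auto simp: tight_def slack_def)
qed

lemma tightD:
  assumes "tight Z"
  shows "Z \<subseteq> V" "Z \<noteq> V" "Z \<noteq> {}" "finite Z" "slack Z = 0"
  using assms slack_V finite_sub by (auto simp: tight_def)

lemma two_le_card: "finite S \<Longrightarrow> p \<in> S \<Longrightarrow> q \<in> S \<Longrightarrow> p \<noteq> q \<Longrightarrow> 2 \<le> card S"
  using card_mono[of S "{p, q}"] by simp

text \<open>A vertex with at most one neighbour in \<open>Z\<close> could be deleted, leaving a
  nonempty set of negative slack.\<close>

lemma tight_nb:
  assumes "tight Z" "2 \<le> card Z" "v \<in> Z"
  shows "2 \<le> card (nb v \<inter> Z)"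
proof -
  have "card (Z - {v}) \<noteq> 0"
    using assms by simp
  then have "Z - {v} \<noteq> {}" by force
  then have "0 \<le> slack (Z - {v})"
    using tightD[OF assms(1)] by (intro slack_nonneg) auto
  then show ?thesis using slack_remove[of Z v] tightD[OF assms(1)] assms by simp
qed

text \<open>Deleting both vertices gives slack
  \<open>card (nb u \<inter> Z) + card (nb v \<inter> Z) - 5\<close>, since their common edge is
  lost only once. Two adjacent vertices of degree 3 in a tight set thus have together at most one
  neighbour outside it.\<close>

lemma tight_cubic_pair:
  assumes "tight Z" "u \<in> Z" "v \<in> Z" "u \<in> nb v"
  shows "5 \<le> card (nb u \<inter> Z) + card (nb v \<inter> Z)"
proof -
  have uv: "u \<noteq> v" using assms by auto
  have c: "4 \<le> card Z"
    by (rule tight_card[OF assms(1) two_le_card[OF tightD(4)[OF assms(1)] assms(2,3) uv]])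
  have "card (Z - {u} - {v}) \<noteq> 0"
    using assms uv c by simp
  then have "Z - {u} - {v} \<noteq> {}" by force
  then have "0 \<le> slack (Z - {u} - {v})"
    using tightD[OF assms(1)] assms(2) by (intro slack_nonneg) auto
  moreover have "slack (Z - {u} - {v}) = slack (Z - {u}) - 2 + int (card (nb v \<inter> (Z - {u})))"
    using assms uv tightD[OF assms(1)] by (intro slack_remove) auto
  moreover have "slack (Z - {u}) = slack Z - 2 + int (card (nb u \<inter> Z))"
    using assms tightD[OF assms(1)] by (intro slack_remove) auto
  moreover have "card (nb v \<inter> (Z - {u})) = card (nb v \<inter> Z) - 1"
  proof -
    have "nb v \<inter> (Z - {u}) = (nb v \<inter> Z) - {u}" by auto
    then show ?thesis using assms by (simp add: card_Diff_singleton)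
  qed
  moreover have "0 < card (nb v \<inter> Z)" using assms by (auto simp: card_gt_0_iff)
  ultimately show ?thesis using tightD(5)[OF assms(1)] by simp
qed

text \<open>The slacks of \<open>A\<close> and \<open>B\<close> sum to \<open>0\<close>, and on the
  other side of the modular identity all three terms are nonnegative.\<close>

lemma tight_Un_Int:
  assumes "tight A" "tight B" "A \<inter> B \<noteq> {}" "A \<union> B \<noteq> V"
  shows "tight (A \<union> B)" "tight (A \<inter> B)" "cross A B = {}"
proof -
  note a = tightD[OF assms(1)] and b = tightD[OF assms(2)]
  have "0 \<le> slack (A \<union> B)" using a b assms by (intro slack_nonneg) auto
  moreover have "0 \<le> slack (A \<inter> B)" using a b assms by (intro slack_nonneg) auto
  ultimately have "slack (A \<union> B) = 0" "slack (A \<inter> B) = 0" "card (cross A B) = 0"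
    using slack_modular[of A B] a b by auto
  then show "tight (A \<union> B)" "tight (A \<inter> B)" "cross A B = {}"
    using a b assms finite_cross by (auto simp: tight_def)
qed

lemma cubic_subset: "cubic \<subseteq> V"
  by (auto simp: cubic_def)

lemma card_V_ge_5: "5 \<le> card V"
proof -
  have b: "4 * int (card V) - 2 \<le> int (card V) * (int (card V) - 1)"
    using sum_nb_bound[OF order_refl] edges_in_V card_E by simp
  have "2 \<le> card V" by (rule card_V_ge_2)
  moreover have "card V \<noteq> 2 \<and> card V \<noteq> 3 \<and> card V \<noteq> 4" using b by auto
  ultimately show ?thesis by linarith
qed

text \<open>The vertices of degree 3 induce a forest: minimum degree 2 inside \<open>C\<close> would
  give at least \<open>card C\<close> edges, whereas the degree sum \<open>3 * card C\<close> leaves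
  only \<open>card C - 1 - slack (V - C)\<close>.\<close>

lemma cubic_leaf:
  assumes C: "C \<subseteq> cubic" "C \<noteq> {}"
  obtains v where "v \<in> C" "card (nb v \<inter> C) \<le> 1"
proof -
  have "\<exists>v\<in>C. card (nb v \<inter> C) \<le> 1"
  proof (rule ccontr)
    assume "\<not> ?thesis"
    then have ge: "2 \<le> int (card (nb v \<inter> C))" if "v \<in> C" for v using that by force
    have CV: "C \<subseteq> V" using C cubic_subset by auto
    have "int (card C) * 2 \<le> (\<Sum>v\<in>C. int (card (nb v \<inter> C)))"
      using ge by (rule sum_bounded_below)
      then have iC: "int (card C) \<le> edges_in C" using sum_nb[OF order_refl CV] by simp
    have "(\<Sum>v\<in>C. int (card (nb v))) = (\<Sum>v\<in>C. 3)"
      using C by (intro sum.cong) (auto simp: cubic_def)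
    then have s: "3 * int (card C) = edges_in C + 2 * int (card C) + 1 + slack (V - C)"
      using sum_degrees[OF CV] by simp
    show False
    proof (cases "C = V")
      \<comment> \<open>The complement is empty and has slack \<open>-2\<close>, so this case is
        counted separately: it would force \<open>card V = 2\<close>.\<close>
      case True
      then have "3 * int (card V) = 4 * int (card V) - 2"
        using s edges_in_V card_E by (simp add: slack_def)
      then show False using card_V_ge_5 by simp
    next
      case False
      then have "0 \<le> slack (V - C)" using CV C by (intro slack_nonneg) auto
      then show False using s iC by simp
    qed
  qed
  then show thesis using that by blast
qed

lemma clique_tight:
  assumes "clique K" "card K = 4" "K \<subseteq> V"
  shows "tight K"
proof -
  have fK: "finite K" using assms finite_sub by auto
  have "card (nb v \<inter> K) = 3" if "v \<in> K" for v
  proof -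
    have "nb v \<inter> K = K - {v}" using assms(1) that by (auto simp: clique_def)
    then show ?thesis using that assms(2) by simp
  qed
  then have "(\<Sum>v\<in>K. int (card (nb v \<inter> K))) = 12"
    using assms(2) by simp
  then show ?thesis using sum_nb[OF order_refl assms(3)] assms by (auto simp: tight_def slack_def)
qed

section \<open>Admissible reductions\<close>

text \<open>The two conditions match the two ways to fail: without a further common neighbour no
  parallel edges arise, and a set with \<open>u\<close> and \<open>w\<close> but not
  \<open>x\<close> loses a vertex and only the edge \<open>uw\<close>, so it needs one unit of slack
  to spare.\<close>

lemma edge_reduction_admissible:
  assumes ux: "x \<in> nb u" and uw: "w \<in> nb u" and "x \<noteq> w"
    and triangle: "\<And>s. s \<in> nb u \<Longrightarrow> s \<in> nb w \<Longrightarrow> s = x"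
    and no_tight: "\<And>Z. tight Z \<Longrightarrow> u \<in> Z \<Longrightarrow> w \<in> Z \<Longrightarrow> x \<in> Z"
  shows "\<exists>M. admissible_edge_reduction (V, E) M"
proof -
  define \<phi> where "\<phi> = (\<lambda>v. if v = w then u else v)"
  define E0 where "E0 = E - {{u, x}} - {{u, w}}"
  define H where "H = (V - {w}, (`) \<phi> ` E0)"
  have uV: "u \<in> V" and wV: "w \<in> V" and xV: "x \<in> V"
    using ux uw nb_subset nb_sym by blast+
  have uw_ne: "u \<noteq> w" using uw by auto
  have e1: "{u, x} \<in> E" and e2: "{u, w} \<in> E" using ux uw by (auto simp: nb_def)
  have e12: "{u, x} \<noteq> {u, w}" using \<open>x \<noteq> w\<close> by (auto simp: doubleton_eq_iff)
  have fE0: "finite E0" using finite_E by (simp add: E0_def)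
  have \<phi>_id: "\<phi> ` e = e" if "w \<notin> e" for e
    using that by (force simp: \<phi>_def)
  have \<phi>_w: "\<phi> ` {w, p} = {u, p}" if "p \<noteq> w" for p
    using that by (auto simp: \<phi>_def)
  have w_edge: "\<exists>p. e = {w, p} \<and> p \<in> nb w \<and> p \<noteq> w \<and> p \<noteq> u" if "e \<in> E0" "w \<in> e" for e
  proof -
    have "e \<in> E" using that by (simp add: E0_def)
    then obtain p q where pq: "e = {p, q}" "p \<noteq> q" "q \<in> nb p"
      by (rule edge_cases)
    then have "e = {w, p} \<and> p \<in> nb w \<and> p \<noteq> w \<or> e = {w, q} \<and> q \<in> nb w \<and> q \<noteq> w"
      using \<open>w \<in> e\<close> nb_sym[of q p] by auto
    then show ?thesis using that by (auto simp: E0_def insert_commute)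
  qed
  \<comment> \<open>An edge at \<open>w\<close> and an edge avoiding \<open>w\<close> can become
    parallel only through a common neighbour of \<open>u\<close> and \<open>w\<close>, hence through
    \<open>x\<close>; but \<open>{u, x}\<close> has been deleted.\<close>
  have mixed: False if "e \<in> E0" "e' \<in> E0" "w \<in> e" "w \<notin> e'" "\<phi> ` e = \<phi> ` e'" for e e'
  proof -
    obtain p where p: "e = {w, p}" "p \<in> nb w" "p \<noteq> w"
      using w_edge[OF \<open>e \<in> E0\<close> \<open>w \<in> e\<close>] by blast
    then have "e' = {u, p}" using that \<phi>_id \<phi>_w by simp
    moreover from this have "p \<in> nb u" using that by (auto simp: E0_def nb_def)
    then have "p = x" using p triangle by simp
    ultimately show False using that by (simp add: E0_def)
  qed
  have inj: "inj_on ((`) \<phi>) E0"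
  proof (rule inj_onI)
    fix e e' assume e: "e \<in> E0" "e' \<in> E0" and eq: "\<phi> ` e = \<phi> ` e'"
    show "e = e'"
    proof (cases "w \<in> e"; cases "w \<in> e'")
      assume w: "w \<in> e" "w \<in> e'"
      obtain p where p: "e = {w, p}" "p \<noteq> w" "p \<noteq> u" using w_edge[OF e(1) w(1)] by blast
      obtain q where q: "e' = {w, q}" "q \<noteq> w" "q \<noteq> u" using w_edge[OF e(2) w(2)] by blast
      have "{u, p} = {u, q}" using eq p q \<phi>_w by simp
      then show ?thesis using p q by (auto simp: doubleton_eq_iff)
    next
      assume "w \<in> e" "w \<notin> e'" then show ?thesis using mixed e eq by blast
    next
      assume "w \<notin> e" "w \<in> e'" then show ?thesis using mixed e eq[symmetric] by blast
    next
      assume "w \<notin> e" "w \<notin> e'" then show ?thesis using eq \<phi>_id by simp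
    qed
  qed
  have "\<phi> ` V = V - {w}" using uV uw_ne by (auto simp: \<phi>_def)
  \<comment> \<open>The subtracted loop \<open>{u}\<close> is the image of \<open>{u, w}\<close>;
    injectivity on \<open>E0\<close> turns the remaining multiset into a set.\<close>
  moreover have "image_mset ((`) \<phi>) (mset_set E - {#{u, x}#}) - {#{u}#} = mset_set ((`) \<phi> ` E0)"
  proof -
    have "mset_set E = add_mset {u, x} (add_mset {u, w} (mset_set E0))"
      using e1 e2 e12 finite_E unfolding E0_def
      by (metis Diff_iff finite_Diff mset_set.remove singletonD)
    moreover have "\<phi> ` {u, w} = {u}" by (auto simp: \<phi>_def)
    ultimately show ?thesis
      using image_mset_mset_set[OF inj] by simp
  qed
  ultimately have M: "contract_edge u w (delete_edge {u, x} (multigraph_of (V, E))) = multigraph_of H"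
    by (simp add: contract_edge_def delete_edge_def multigraph_of_def H_def \<phi>_def Let_def)
  have "card E0 = card E - 2"
    using e1 e2 e12 finite_E by (simp add: E0_def card_Diff_singleton)
  moreover have "2 \<le> card E" using two_le_card[OF finite_E e1 e2 e12] .
  ultimately have cE0: "int (card E0) = 2 * int (card V) - 3" using card_E by simp
  have cV: "int (card (V - {w})) = int (card V) - 1"
    using card_Suc_Diff1[OF finite_V wV] by linarith
  have simple: "simple_graph H"
  proof -
    have "\<phi> ` e \<subseteq> V - {w} \<and> card (\<phi> ` e) = 2" if e: "e \<in> E0" for e
    proof (cases "w \<in> e")
      case True
      then obtain p where p: "e = {w, p}" "p \<in> nb w" "p \<noteq> w" "p \<noteq> u" using w_edge[OF e True] by blast
      then show ?thesis using \<phi>_w uV uw_ne nb_subset by auto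
    next
      case False
      then show ?thesis using \<phi>_id e edge_subset edge_card by (auto simp: E0_def)
    qed
    then show ?thesis using finite_V by (auto simp: simple_graph_def H_def)
  qed
  have sparse': "int (card F') \<le> 2 * int (card (\<Union>F')) - 2"
    if F': "F' \<subset> (`) \<phi> ` E0" "F' \<noteq> {}" for F'
  proof -
    \<comment> \<open>The bound is checked on the preimage \<open>F\<close> in the original graph,
      which has equally many edges.\<close>
    define F where "F = {e \<in> E0. \<phi> ` e \<in> F'}"
    have F'F: "F' = (`) \<phi> ` F" using F' by (auto simp: F_def)
    have FE0: "F \<subseteq> E0" by (auto simp: F_def)
    then have "inj_on ((`) \<phi>) F" using inj inj_on_subset by blast
    then have cF: "card F' = card F" using F'F card_image by blast
    have F_ne: "F \<noteq> {}" "F \<noteq> E0" using F' F'F by auto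
    have FE: "F \<subset> E" using FE0 e1 by (auto simp: E0_def)
    define S where "S = \<Union>F"
    have SV: "S \<subseteq> V" using FE edge_subset by (auto simp: S_def)
    have fS: "finite S" using SV finite_sub by blast
    have UF': "\<Union>F' = \<phi> ` S" by (auto simp: F'F S_def)
    have base: "int (card F) \<le> 2 * int (card S) - 2"
      using sparse[OF FE] F_ne by (simp add: S_def)
    show ?thesis
    proof (cases "u \<in> S \<and> w \<in> S")
      case False
      then have "inj_on \<phi> S" by (auto simp: inj_on_def \<phi>_def)
      then show ?thesis using base cF UF' card_image by metis
    next
      case True
      then have "\<phi> ` S = S - {w}" using uw_ne by (auto simp: \<phi>_def)
      then have cS: "int (card (\<Union>F')) = int (card S) - 1"
        using UF' card_Suc_Diff1[OF fS, of w] True by simp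
      have FS: "insert {u, w} F \<subseteq> {e \<in> E. e \<subseteq> S}"
        using True e2 FE by (auto simp: S_def)
      have nF: "{u, w} \<notin> F" "{u, x} \<notin> F" using FE0 by (auto simp: E0_def)
      have fF: "finite F" using FE finite_E finite_subset by blast
      have fI: "finite {e \<in> E. e \<subseteq> S}" using finite_E by simp
      \<comment> \<open>Identifying \<open>u\<close> and \<open>w\<close> costs one vertex, so two
        edges must be saved: both removed edges if \<open>x \<in> S\<close>, otherwise
        \<open>{u, w}\<close> and the spare slack of a set that is not tight. For
        \<open>S = V\<close> it suffices that \<open>F\<close> is proper in
        \<open>E0\<close>.\<close>
      have "int (card F) \<le> 2 * int (card S) - 4"
      proof (cases "S = V")
        case True
        have "card F < card E0" using FE0 F_ne fE0 by (intro psubset_card_mono) auto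
        then show ?thesis using cE0 True by simp
      next
        case SneV: False
        then have fS0: "0 \<le> slack S" using SV True by (intro slack_nonneg) auto
        show ?thesis
        proof (cases "x \<in> S")
          case True
          then have "insert {u, x} (insert {u, w} F) \<subseteq> {e \<in> E. e \<subseteq> S}"
            using FS e1 \<open>u \<in> S \<and> w \<in> S\<close> by auto
          from card_mono[OF fI this] have "card F + 2 \<le> card {e \<in> E. e \<subseteq> S}"
            using nF fF e12 by simp
          then show ?thesis using fS0 by (simp add: slack_def edges_in_def)
        next
          case False
          then have "\<not> tight S" using no_tight True by blast
          then have "0 < slack S" using fS0 SV True by (auto simp: tight_def)
          moreover have "card F + 1 \<le> card {e \<in> E. e \<subseteq> S}"
            using card_mono[OF fI FS] nF fF by simp
          ultimately show ?thesis by (simp add: slack_def edges_in_def)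
        qed
      qed
      then show ?thesis using cS cF by simp
    qed
  qed
  have "M22_circuit H"
    using simple sparse' cE0 cV card_image[OF inj] by (auto simp: M22_circuit_def H_def)
  then have "admissible_edge_reduction (V, E) (contract_edge u w (delete_edge {u, x} (multigraph_of (V, E))))"
    using M e1 e2 \<open>x \<noteq> w\<close> unfolding admissible_edge_reduction_def edge_reduction_def snd_conv
    by blast
  then show ?thesis by blast
qed

end

section \<open>Graphs without reductions and their blocking tight sets\<close>

locale irreducible = circuit +
  assumes no_K4: "\<not> (\<exists>H. K4_minus_reduction (V, E) H)"
    and no_admissible: "\<not> (\<exists>M. admissible_edge_reduction (V, E) M)"
begin

text \<open>The obstruction to deleting \<open>ux\<close> and contracting \<open>uw\<close>: with
  parallel edges excluded, only a tight set is left to prevent admissibility.\<close>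

lemma blocker:
  assumes "x \<in> nb u" "w \<in> nb u" "x \<noteq> w"
    and "\<And>s. s \<in> nb u \<Longrightarrow> s \<in> nb w \<Longrightarrow> s = x"
  obtains Z where "tight Z" "2 \<le> card Z" "u \<in> Z" "w \<in> Z" "x \<notin> Z"
proof -
  have "\<exists>Z. tight Z \<and> u \<in> Z \<and> w \<in> Z \<and> x \<notin> Z"
  proof (rule ccontr)
    assume "\<not> ?thesis"
    then have "\<And>Z. tight Z \<Longrightarrow> u \<in> Z \<Longrightarrow> w \<in> Z \<Longrightarrow> x \<in> Z" by blast
    from edge_reduction_admissible[OF assms this] show False using no_admissible by simp
  qed
  then obtain Z where Z: "tight Z" "u \<in> Z" "w \<in> Z" "x \<notin> Z" by blast
  moreover have "2 \<le> card Z"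
    using two_le_card[OF tightD(4)[OF Z(1)] Z(2,3)] assms(2) nb_irrefl by metis
  ultimately show thesis using that by blast
qed

lemma K4_closed:
  assumes "nb u = {v, a, b}" "nb v = {u, a, b}" "u \<in> cubic" "v \<in> cubic"
  shows "b \<in> nb a"
proof (rule ccontr)
  assume "b \<notin> nb a"
  then have "{a, b} \<notin> E" "{u, v} \<in> E" "card (nb u) = 3" "card (nb v) = 3"
    using assms nb_iff[of v u] by (auto simp: cubic_def nb_iff)
  then have "K4_minus_reduction (V, E)
    (V - {u, v}, {e \<in> E. u \<notin> e \<and> v \<notin> e} \<union> {{a, b}})"
    using assms(1,2) unfolding K4_minus_reduction_def degree_eq neighbours_eq fst_conv snd_conv
    by blast
  then show False using no_K4 by blast
qed

end

context circuit
begin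

section \<open>Vertices of degree 3\<close>

lemma tight_outside:
  assumes "tight Z" "z \<in> V" "z \<notin> Z" "insert z Z \<noteq> V"
  shows "card (nb z \<inter> Z) \<le> 2"
proof -
  have "0 \<le> slack (insert z Z)"
    using tightD[OF assms(1)] assms by (intro slack_nonneg) auto
  then show ?thesis
    using slack_insert[of Z z] tightD[OF assms(1)] assms by simp
qed

text \<open>Since \<open>tight_nb\<close> requires two neighbours, both candidates are used. For
  \<open>v\<close> of degree 3, one neighbour outside \<open>Z\<close> thus pulls in the other
  two.\<close>

lemma tight_nb_two:
  assumes "tight Z" "2 \<le> card Z" "v \<in> Z" "nb v \<inter> Z \<subseteq> {x, y}"
  shows "x \<in> Z" "y \<in> Z"
proof -
  have c: "2 \<le> card (nb v \<inter> Z)" using tight_nb assms by blast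
  have "card (nb v \<inter> Z) \<le> 1" if "x \<notin> Z \<or> y \<notin> Z"
  proof -
    from that assms(4) have "nb v \<inter> Z \<subseteq> {x} \<or> nb v \<inter> Z \<subseteq> {y}" by auto
    then show ?thesis
      using card_mono[of "{x}" "nb v \<inter> Z"] card_mono[of "{y}" "nb v \<inter> Z"] by auto
  qed
  then show "x \<in> Z" "y \<in> Z" using c by force+
qed

lemma cubic_nb:
  assumes "v \<in> cubic"
  obtains a b c where "nb v = {a, b, c}" "a \<noteq> b" "a \<noteq> c" "b \<noteq> c"
  using assms by (auto simp: cubic_def card_3_iff)

lemma cubic_nb_of:
  assumes "v \<in> cubic" "a \<in> nb v"
  obtains b c where "nb v = {a, b, c}" "a \<noteq> b" "a \<noteq> c" "b \<noteq> c"
proof -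
  have "card (nb v - {a}) = 2" using assms by (simp add: cubic_def)
  then obtain b c where bc: "nb v - {a} = {b, c}" "b \<noteq> c" by (auto simp: card_2_iff)
  then have "nb v = {a, b, c}" using assms(2) by blast
  moreover have "a \<noteq> b" "a \<noteq> c" using bc by blast+
  ultimately show thesis using that bc(2) by blast
qed

lemma cubic_distinct:
  assumes "v \<in> cubic" "nb v = {x, y, z}"
  shows "x \<noteq> y" "x \<noteq> z" "y \<noteq> z" "v \<noteq> x" "v \<noteq> y" "v \<noteq> z"
proof -
  have "card {x, y, z} = 3" using assms by (simp add: cubic_def)
  then show "x \<noteq> y" "x \<noteq> z" "y \<noteq> z" by (auto simp: card_insert_if split: if_splits)
  show "v \<noteq> x" "v \<noteq> y" "v \<noteq> z" using assms(2) nb_irrefl[of v] by auto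
qed

lemma cliqueI:
  assumes "nb v = {a, b, c}" "b \<in> nb a" "c \<in> nb a" "c \<in> nb b"
  shows "clique (insert v (nb v))"
proof -
  have "v \<in> nb a" "v \<in> nb b" "v \<in> nb c" using assms(1) by (simp_all add: nb_symD)
  moreover have "a \<in> nb b" "a \<in> nb c" "b \<in> nb c" using assms by (simp_all add: nb_symD)
  ultimately show ?thesis using assms by (auto simp: clique_def)
qed

text \<open>A common generalisation of the two situations in which the leaf argument is run: \<open>D\<close> a minimal
  fragment, and \<open>D = V\<close> when there are no such fragments.\<close>

definition confined :: "'a set \<Rightarrow> bool" where
  "confined D \<longleftrightarrow> D \<subseteq> V \<and>
     (\<forall>Z b. tight Z \<and> 2 \<le> card Z \<and> Z \<inter> D \<noteq> {} \<and> b \<in> D - Z \<and> b \<notin> cubic \<longrightarrow> Z \<subseteq> D \<and> D \<noteq> V)"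

text \<open>The minimality clause omits the bound \<open>2 \<le> card (V - D')\<close>, which is
  inherited because the complement grows as \<open>D\<close> shrinks.\<close>

definition min_fragment :: "'a set \<Rightarrow> bool" where
  "min_fragment D \<longleftrightarrow> D \<subseteq> V \<and> tight (V - D) \<and> 2 \<le> card (V - D) \<and> \<not> D \<subseteq> cubic \<and>
     (\<forall>D'. D' \<subset> D \<and> D' \<noteq> {} \<and> tight (V - D') \<longrightarrow> D' \<subseteq> cubic)"

lemma confinedD:
  assumes "confined D" "tight Z" "2 \<le> card Z" "v \<in> Z" "v \<in> D" "b \<in> D" "b \<notin> Z" "b \<notin> cubic"
  shows "Z \<subseteq> D" "D \<noteq> V"
  using assms by (auto simp: confined_def)

lemma tight_Int_nb:
  assumes "tight A" "tight B" "A \<union> B \<noteq> V" "v \<in> A" "v \<in> B" "y \<in> A" "y \<in> B" "y \<noteq> v"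
  shows "2 \<le> card (nb v \<inter> (A \<inter> B))"
proof (rule tight_nb)
  show "tight (A \<inter> B)" using tight_Un_Int assms by blast
  then show "2 \<le> card (A \<inter> B)" using two_le_card[of "A \<inter> B" v y] tightD(4) assms by blast
qed (use assms in auto)

text \<open>As \<open>Z\<close> reaches outside \<open>D\<close>, its union with
  \<open>V - D\<close> is tight, and the complement \<open>D - Z\<close> of that union is a smaller
  set to which minimality applies.\<close>

lemma min_fragment_meet:
  assumes D: "min_fragment D" and Z: "tight Z" "p \<in> Z" "p \<notin> D" "q \<in> Z" "q \<in> D"
    and b: "b \<in> D" "b \<notin> Z"
  shows "b \<in> cubic"
proof -
  have X: "tight (V - D)" "D \<subseteq> V" using D by (auto simp: min_fragment_def)
  have "tight ((V - D) \<union> Z)"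
    using X Z b tightD(1)[OF Z(1)] by (intro tight_Un_Int(1)) auto
  moreover have "(V - D) \<union> Z = V - (D - Z)" using X(2) tightD(1)[OF Z(1)] by auto
  moreover have "D - Z \<subset> D" "D - Z \<noteq> {}" using Z b by auto
  ultimately have "D - Z \<subseteq> cubic"
    using D unfolding min_fragment_def by metis
  then show ?thesis using b by auto
qed

lemma min_fragment_confined:
  assumes D: "min_fragment D" shows "confined D"
proof -
  have "D \<subseteq> V" "D \<noteq> V" using D tightD(3)[of "V - D"] by (auto simp: min_fragment_def)
  moreover have "Z \<subseteq> D" if "tight Z" "Z \<inter> D \<noteq> {}" "b \<in> D - Z" "b \<notin> cubic" for Z b
    using min_fragment_meet[OF D that(1)] that by blast
  ultimately show ?thesis unfolding confined_def by blast
qed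

text \<open>Two neighbours outside would let \<open>v\<close> join the tight set
  \<open>V - D\<close>, making \<open>D - {v}\<close> a smaller fragment that still contains a
  vertex of degree at least 4; three would violate sparsity.\<close>

lemma min_fragment_nb_outside:
  assumes D: "min_fragment D" and v: "v \<in> D" "v \<in> cubic"
  shows "card (nb v - D) \<le> 1"
proof -
  let ?X = "V - D"
  have X: "tight ?X" "D \<subseteq> V" using D by (auto simp: min_fragment_def)
  obtain b where b: "b \<in> D" "b \<notin> cubic" using D by (auto simp: min_fragment_def)
  have "insert v ?X \<noteq> V" using b v X by auto
  then have le: "card (nb v \<inter> ?X) \<le> 2" using X v by (intro tight_outside) auto
  have "card (nb v \<inter> ?X) \<noteq> 2"
  proof
    assume "card (nb v \<inter> ?X) = 2"
    then have "tight (insert v ?X)"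
      using slack_insert[of ?X v] tightD[OF X(1)] X v by (auto simp: tight_def)
    moreover have "insert v ?X = V - (D - {v})" using X v by auto
    moreover have "D - {v} \<subset> D" "D - {v} \<noteq> {}" using b v by auto
    ultimately have "D - {v} \<subseteq> cubic"
      using D unfolding min_fragment_def by metis
    then show False using b v by auto
  qed
  moreover have "nb v \<inter> ?X = nb v - D" using nb_subset by auto
  ultimately show ?thesis using le by simp
qed

text \<open>Three neighbours in a tight set force \<open>insert a Z = V\<close>, so \<open>a\<close>
  has degree 3; the two further neighbours in the tight set \<open>V - D\<close> are too
  many.\<close>

lemma min_fragment_dominated:
  assumes D: "min_fragment D" and a: "a \<in> V" "a \<notin> D" and Z: "tight Z" "a \<notin> Z"
    and three: "3 \<le> card (nb a \<inter> (Z \<inter> D))"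
  shows False
proof -
  have X: "tight (V - D)" "2 \<le> card (V - D)" using D by (auto simp: min_fragment_def)
  have "card (nb a \<inter> (Z \<inter> D)) \<le> card (nb a \<inter> Z)" by (rule card_mono) auto
  then have "insert a Z = V" using tight_outside[OF Z(1) a(1) Z(2)] three by linarith
  then have "V - {a} = Z" using Z(2) by auto
  then have "a \<in> cubic" using tight_remove_cubic[OF a(1)] Z by simp
  moreover have "2 \<le> card (nb a \<inter> (V - D))" using tight_nb[OF X] a by simp
  moreover have "card (nb a \<inter> (V - D) \<union> nb a \<inter> (Z \<inter> D)) \<le> card (nb a)"
    by (rule card_mono) auto
  moreover have "card (nb a \<inter> (V - D) \<union> nb a \<inter> (Z \<inter> D))
      = card (nb a \<inter> (V - D)) + card (nb a \<inter> (Z \<inter> D))"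
    by (rule card_Un_disjoint) auto
  ultimately show False using three by (simp add: cubic_def)
qed

end

section \<open>Cliques at leaves and isolated vertices of the degree 3 forest\<close>

context irreducible
begin

text \<open>If \<open>xy\<close> is missing, a tight set blocks deleting \<open>vz\<close> and
  contracting \<open>vx\<close>; it contains \<open>v\<close>, \<open>x\<close>, \<open>y\<close>
  but not \<open>z\<close>. A second blocking set rules out a missing \<open>xz\<close> or
  \<open>yz\<close>, and then \<open>z\<close> has three neighbours in the first tight set.\<close>

lemma confined_adjacent:
  assumes D: "confined D" "v \<in> D" "v \<in> cubic" and nb: "nb v = {x, y, z}" "{x, y, z} \<subseteq> D"
    and nc: "{x, y, z} \<inter> cubic = {}"
  shows "y \<in> nb x"
proof (rule ccontr)
  assume yx: "y \<notin> nb x"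
  have dist: "x \<noteq> y" "x \<noteq> z" "y \<noteq> z"
    using cubic_distinct[OF D(3) nb(1)] by simp_all
  have ne: "v \<noteq> x" "v \<noteq> y" "v \<noteq> z" using cubic_distinct[OF D(3) nb(1)] by simp_all
  obtain Z where Z: "tight Z" "2 \<le> card Z" "v \<in> Z" "x \<in> Z" "z \<notin> Z"
    by (rule blocker[of z v x]) (use nb dist yx in auto)
  have ZD: "Z \<subseteq> D" "D \<noteq> V"
    using confinedD[OF D(1) Z(1,2,3) D(2) _ Z(5)] nb nc by auto
  have DV: "D \<subseteq> V" using D by (simp add: confined_def)
  have "nb v \<inter> Z \<subseteq> {x, y}" using nb(1) Z(5) by auto
  then have yZ: "y \<in> Z" by (rule tight_nb_two[OF Z(1-3)])
  \<comment> \<open>Both tight sets lie in \<open>D \<noteq> V\<close>, so their intersection is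
    tight and must contain two neighbours of \<open>v\<close>.\<close>
  have contra: False
    if Z': "tight Z'" "Z' \<subseteq> D" "v \<in> Z'" "p \<in> Z" "p \<in> Z'" "p \<noteq> v" "nb v \<inter> (Z \<inter> Z') \<subseteq> {p}" for Z' p
  proof -
    have "Z \<union> Z' \<noteq> V" using ZD Z'(2) DV by blast
    from tight_Int_nb[OF Z(1) Z'(1) this Z(3) Z'(3-6)]
    have "2 \<le> card (nb v \<inter> (Z \<inter> Z'))" .
    then show False using card_mono[OF _ Z'(7)] by simp
  qed
  have "z \<in> nb x"
  proof (rule ccontr)
    assume "z \<notin> nb x"
    obtain Z' where Z': "tight Z'" "2 \<le> card Z'" "v \<in> Z'" "x \<in> Z'" "y \<notin> Z'"
      by (rule blocker[of y v x]) (use nb dist \<open>z \<notin> nb x\<close> in auto)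
    have "Z' \<subseteq> D"
      using confinedD[OF D(1) Z'(1,2,3) D(2) _ Z'(5)] nb nc by auto
    moreover have "nb v \<inter> (Z \<inter> Z') \<subseteq> {x}" using nb(1) Z(5) Z'(5) by auto
    ultimately show False using contra[of Z' x] Z Z' ne by blast
  qed
  moreover have "z \<in> nb y"
  proof (rule ccontr)
    assume "z \<notin> nb y"
    obtain Z' where Z': "tight Z'" "2 \<le> card Z'" "v \<in> Z'" "y \<in> Z'" "x \<notin> Z'"
      by (rule blocker[of x v y]) (use nb dist \<open>z \<notin> nb y\<close> in auto)
    have "Z' \<subseteq> D"
      using confinedD[OF D(1) Z'(1,2,3) D(2) _ Z'(5)] nb nc by auto
    moreover have "nb v \<inter> (Z \<inter> Z') \<subseteq> {y}" using nb(1) Z(5) Z'(5) by auto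
    ultimately show False using contra[of Z' y] Z' yZ ne by blast
  qed
  moreover have "z \<in> nb v" using nb by simp
  ultimately have "{v, x, y} \<subseteq> nb z \<inter> Z" using Z yZ by (auto dest: nb_symD)
  from card_mono[OF _ this] have "3 \<le> card (nb z \<inter> Z)" using ne dist by simp
  moreover have "insert z Z \<noteq> V" using ZD DV nb by auto
  ultimately show False using tight_outside[OF Z(1) _ Z(5)] nb DV by auto
qed

text \<open>The hypotheses determine \<open>nb u = {v, a, b}\<close>, so the absence of a reduction
  at the pair \<open>u\<close>, \<open>v\<close> supplies the last edge \<open>ab\<close>.\<close>

lemma cubic_pair_clique:
  assumes "nb v = {u, a, b}" "v \<in> cubic" "u \<in> cubic" "a \<in> nb u" "b \<in> nb u"
  shows "clique (insert v (nb v))"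
proof -
  have ne: "v \<noteq> a" "v \<noteq> b" "a \<noteq> b"
    using cubic_distinct[OF assms(2,1)] by simp_all
  have "v \<in> nb u" using assms(1) by (simp add: nb_symD)
  then have "{v, a, b} \<subseteq> nb u" using assms by auto
  moreover have "card (nb u) = 3" using assms by (simp add: cubic_def)
  ultimately have "nb u = {v, a, b}"
    using card_subset_eq[of "nb u" "{v, a, b}"] ne by simp
  then have "b \<in> nb a" using K4_closed[of u v a b] assms by auto
  then show ?thesis using assms cliqueI by blast
qed

text \<open>Again two blocking sets share \<open>v\<close> and only one of its neighbours, here
  \<open>u\<close>. The first one contains all neighbours of \<open>u\<close> by
  \<open>tight_cubic_pair\<close>, so \<open>ub\<close> is missing too and the second one
  exists.\<close>

lemma confined_adjacent_cubic:
  assumes D: "confined D" "v \<in> D" "v \<in> cubic" and nb: "nb v = {u, a, b}" "{u, a, b} \<subseteq> D"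
    and nc: "u \<in> cubic" "a \<notin> cubic" "b \<notin> cubic"
  shows "a \<in> nb u"
proof (rule ccontr)
  assume au: "a \<notin> nb u"
  have dist: "u \<noteq> a" "u \<noteq> b" "a \<noteq> b"
    using cubic_distinct[OF D(3) nb(1)] by simp_all
  have ne: "v \<noteq> u" "v \<noteq> a" "v \<noteq> b" using cubic_distinct[OF D(3) nb(1)] by simp_all
  have ua: "u \<notin> nb a" using au nb_symD by metis
  obtain Z where Z: "tight Z" "2 \<le> card Z" "v \<in> Z" "a \<in> Z" "b \<notin> Z"
    by (rule blocker[of b v a]) (use nb dist ua in auto)
  have nbZ: "nb v \<inter> Z \<subseteq> {u, a}" using nb(1) Z(5) by auto
  then have uZ: "u \<in> Z" by (rule tight_nb_two[OF Z(1-3)])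
  from nbZ have "card (nb v \<inter> Z) \<le> 2" using card_mono[OF _ nbZ] dist by simp
  moreover have "5 \<le> card (nb u \<inter> Z) + card (nb v \<inter> Z)"
    by (rule tight_cubic_pair[OF Z(1) uZ Z(3)]) (simp add: nb)
  moreover have "card (nb u) = 3" using nc(1) by (simp add: cubic_def)
  ultimately have "card (nb u) \<le> card (nb u \<inter> Z)" by linarith
  then have "nb u \<inter> Z = nb u" by (intro card_seteq) auto
  then have "nb u \<subseteq> Z" by blast
  then have "b \<notin> nb u" using Z(5) by auto
  then have bu: "u \<notin> nb b" using nb_symD by metis
  obtain Z' where Z': "tight Z'" "2 \<le> card Z'" "v \<in> Z'" "b \<in> Z'" "a \<notin> Z'"
    by (rule blocker[of a v b]) (use nb dist bu in auto)
  have "nb v \<inter> Z' \<subseteq> {u, b}" using nb(1) Z'(5) by auto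
  then have uZ': "u \<in> Z'" by (rule tight_nb_two[OF Z'(1-3)])
  have "Z \<subseteq> D" "D \<noteq> V"
    using confinedD[OF D(1) Z(1,2,3) D(2) _ Z(5)] nb nc by auto
  moreover have "Z' \<subseteq> D"
    using confinedD[OF D(1) Z'(1,2,3) D(2) _ Z'(5)] nb nc by auto
  moreover have "D \<subseteq> V" using D by (simp add: confined_def)
  ultimately have "Z \<union> Z' \<noteq> V" by blast
  from tight_Int_nb[OF Z(1) Z'(1) this Z(3) Z'(3) uZ uZ' ne(1)[symmetric]]
  have "2 \<le> card (nb v \<inter> (Z \<inter> Z'))" .
  moreover have "nb v \<inter> (Z \<inter> Z') \<subseteq> {u}" using nb(1) Z(5) Z'(5) by auto
  ultimately show False using card_mono[of "{u}" "nb v \<inter> (Z \<inter> Z')"] by simp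
qed

lemma cubic_nb_cases:
  assumes v: "v \<in> cubic" and le: "card (nb v \<inter> cubic \<inter> D) \<le> 1"
    and "nb v \<subseteq> D"
  obtains a b c where "nb v = {a, b, c}" "b \<notin> cubic" "c \<notin> cubic"
proof -
  obtain a b c where abc: "nb v = {a, b, c}" "a \<noteq> b" "a \<noteq> c" "b \<noteq> c" using cubic_nb[OF v] .
  have "nb v \<inter> cubic \<inter> D = nb v \<inter> cubic" using assms by auto
  moreover have "2 \<le> card (nb v \<inter> cubic)"
    if "p \<in> nb v" "p \<in> cubic" "q \<in> nb v" "q \<in> cubic" "p \<noteq> q" for p q
    using that by (intro two_le_card[of _ p q]) auto
  ultimately have "p = q" if "p \<in> nb v" "p \<in> cubic" "q \<in> nb v" "q \<in> cubic" for p q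
    using that le by fastforce
  then have "b \<notin> cubic \<and> c \<notin> cubic \<or> a \<notin> cubic \<and> c \<notin> cubic \<or> a \<notin> cubic \<and> b \<notin> cubic"
    using abc by blast
  moreover have "nb v = {b, a, c}" "nb v = {c, a, b}" using abc by auto
  ultimately show thesis using that abc(1) by blast
qed

lemma confined_clique:
  assumes D: "confined D" "v \<in> D" "v \<in> cubic" and sub: "nb v \<subseteq> D"
    and le: "card (nb v \<inter> cubic \<inter> D) \<le> 1"
  shows "clique (insert v (nb v))"
proof -
  obtain a b c where abc: "nb v = {a, b, c}" "b \<notin> cubic" "c \<notin> cubic"
    using cubic_nb_cases[OF D(3) le sub] .
  show ?thesis
  proof (cases "a \<in> cubic")
    case True
    have "nb v = {a, c, b}" using abc by auto
    then have "b \<in> nb a" "c \<in> nb a"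
      using confined_adjacent_cubic[OF D, of a b c] confined_adjacent_cubic[OF D, of a c b] abc sub True
      by auto
    then show ?thesis using cubic_pair_clique[of v a b c] abc D True by blast
  next
    case False
    have e: "nb v = {a, c, b}" "nb v = {b, c, a}" using abc by auto
    have "b \<in> nb a" by (rule confined_adjacent[OF D abc(1)]) (use abc sub False in auto)
    moreover have "c \<in> nb a" by (rule confined_adjacent[OF D e(1)]) (use abc sub False in auto)
    moreover have "c \<in> nb b" by (rule confined_adjacent[OF D e(2)]) (use abc sub False in auto)
    ultimately show ?thesis using cliqueI abc by blast
  qed
qed

text \<open>If \<open>v\<close> has a neighbour \<open>a\<close> outside \<open>D\<close>, a
  blocking set with \<open>v\<close> and \<open>a\<close> would cross the boundary of
  \<open>D\<close> and, by \<open>min_fragment_meet\<close>, contain every vertex of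
  \<open>D\<close> of degree at least 4. This yields edges at \<open>a\<close>; the edge
  \<open>ub\<close> needs a blocking set that avoids \<open>a\<close>.\<close>

lemma min_fragment_clique:
  assumes D: "min_fragment D" and v: "v \<in> D" "v \<in> cubic"
    and le: "card (nb v \<inter> cubic \<inter> D) \<le> 1"
  shows "clique (insert v (nb v))"
proof (cases "nb v \<subseteq> D")
  case True
  then show ?thesis using confined_clique min_fragment_confined D v le by blast
next
  case False
  have le1: "card (nb v - D) \<le> 1" by (rule min_fragment_nb_outside[OF D v])
  from False obtain a where a: "a \<in> nb v" "a \<notin> D" by auto
  have aV: "a \<in> V" using a nb_subset by auto
  have only: "p = a" if "p \<in> nb v" "p \<notin> D" for p
    using two_le_card[of "nb v - D" p a] that a le1 by fastforce
  have "\<exists>u b. nb v = {a, u, b} \<and> a \<noteq> u \<and> a \<noteq> b \<and> u \<noteq> b \<and> u \<in> D \<and> b \<in> D \<and> b \<notin> cubic"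
  proof -
    obtain b c where bc: "nb v = {a, b, c}" "a \<noteq> b" "a \<noteq> c" "b \<noteq> c"
      using cubic_nb_of[OF v(2) a(1)] .
    have bcD: "b \<in> D" "c \<in> D" using only[of b] only[of c] bc by auto
    have "\<not> (b \<in> cubic \<and> c \<in> cubic)"
    proof
      assume "b \<in> cubic \<and> c \<in> cubic"
      then have "2 \<le> card (nb v \<inter> cubic \<inter> D)"
        using bc bcD by (intro two_le_card[of _ b c]) simp_all
      then show False using le by simp
    qed
    moreover have "nb v = {a, c, b}" using bc(1) by auto
    ultimately show ?thesis using bc bcD by metis
  qed
  then obtain u b where nb: "nb v = {a, u, b}" "a \<noteq> u" "a \<noteq> b" "u \<noteq> b"
    and uD: "u \<in> D" and bD: "b \<in> D" "b \<notin> cubic" by blast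
  have ne: "v \<noteq> u" "v \<noteq> a" "v \<noteq> b" using cubic_distinct[OF v(2) nb(1)] by simp_all
  have ua: "u \<in> nb a"
  proof (rule ccontr)
    assume "u \<notin> nb a"
    obtain Z where Z: "tight Z" "2 \<le> card Z" "v \<in> Z" "a \<in> Z" "b \<notin> Z"
      by (rule blocker[of b v a]) (use nb \<open>u \<notin> nb a\<close> in auto)
    show False using min_fragment_meet[OF D Z(1,4) a(2) Z(3) v(1) bD(1) Z(5)] bD by simp
  qed
  show ?thesis
  proof (cases "u \<in> cubic")
    case True
    \<comment> \<open>Both \<open>u\<close> and \<open>v\<close> are adjacent to \<open>a\<close>,
      so each has at most two neighbours in \<open>Z\<close>, one short of the five required of an
      adjacent pair.\<close>
    have "b \<in> nb u"
    proof (rule ccontr)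
      assume bu: "b \<notin> nb u"
      then have ub: "u \<notin> nb b" using nb_symD by metis
      obtain Z where Z: "tight Z" "2 \<le> card Z" "v \<in> Z" "b \<in> Z" "a \<notin> Z"
        by (rule blocker[of a v b]) (use nb ub in auto)
      have nbZ: "nb v \<inter> Z \<subseteq> {u, b}" using nb(1) Z(5) by auto
      then have uZ: "u \<in> Z" by (rule tight_nb_two[OF Z(1-3)])
      from nbZ have "card (nb v \<inter> Z) \<le> 2" using card_mono[OF _ nbZ] nb(4) by simp
      moreover have "nb u \<inter> Z \<subseteq> nb u - {a}" using Z by auto
      then have "card (nb u \<inter> Z) \<le> card (nb u - {a})" by (intro card_mono) auto
      then have "card (nb u \<inter> Z) \<le> 2" using True ua nb_sym[of a u] by (simp add: cubic_def)
      moreover have "5 \<le> card (nb u \<inter> Z) + card (nb v \<inter> Z)"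
        by (rule tight_cubic_pair[OF Z(1) uZ Z(3)]) (simp add: nb)
      ultimately show False by simp
    qed
    moreover have "a \<in> nb u" using ua nb_symD by simp
    moreover have "nb v = {u, a, b}" using nb(1) by auto
    ultimately show ?thesis using cubic_pair_clique[of v u a b] v True by blast
  next
    case False
    have ba: "b \<in> nb a"
    proof (rule ccontr)
      assume "b \<notin> nb a"
      obtain Z where Z: "tight Z" "2 \<le> card Z" "v \<in> Z" "a \<in> Z" "u \<notin> Z"
        by (rule blocker[of u v a]) (use nb \<open>b \<notin> nb a\<close> in auto)
      show False using min_fragment_meet[OF D Z(1,4) a(2) Z(3) v(1) uD Z(5)] False by simp
    qed
    have "b \<in> nb u"
    proof (rule ccontr)
      assume bu: "b \<notin> nb u"
      then have ub: "u \<notin> nb b" using nb_symD by metis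
      have bn: "v \<in> nb b" "a \<in> nb b" using nb(1) ba by (simp_all add: nb_symD)
      obtain Z where Z: "tight Z" "2 \<le> card Z" "b \<in> Z" "v \<in> Z" "a \<notin> Z"
        by (rule blocker[of a b v]) (use nb(1) ub ne bn in auto)
      have "nb v \<inter> Z \<subseteq> {u, b}" using nb(1) Z(5) by auto
      then have uZ: "u \<in> Z" by (rule tight_nb_two[OF Z(1,2,4)])
      have va: "v \<in> nb a" using a by (simp add: nb_symD)
      have "{v, u, b} \<subseteq> nb a \<inter> (Z \<inter> D)" using Z uZ va ua ba v(1) uD bD(1) by auto
      from card_mono[OF _ this] have "3 \<le> card (nb a \<inter> (Z \<inter> D))" using ne nb by simp
      then show False using min_fragment_dominated[OF D aV a(2) Z(1,5)] by simp
    qed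
    then show ?thesis using cliqueI[OF nb(1) ua ba] by blast
  qed
qed

end

section \<open>Closed neighbourhoods that form a K4\<close>

context circuit
begin

lemma slack_singleton: "slack {a} = 0"
  using slack_insert[of "{}" a] by (simp add: slack_def)

lemma cubic_clique:
  assumes v: "v \<in> cubic" and K: "clique (insert v (nb v))"
  shows "card (insert v (nb v)) = 4" "insert v (nb v) \<subseteq> V" "tight (insert v (nb v))"
    and "\<And>p. p \<in> insert v (nb v) \<Longrightarrow> p \<in> cubic \<Longrightarrow> nb p = insert v (nb v) - {p}"
proof -
  show c: "card (insert v (nb v)) = 4" using v by (simp add: cubic_def)
  show V: "insert v (nb v) \<subseteq> V" using v cubic_subset nb_subset by auto
  show "tight (insert v (nb v))" using clique_tight[OF K c V] .
  fix p assume p: "p \<in> insert v (nb v)" "p \<in> cubic"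
  have "insert v (nb v) - {p} \<subseteq> nb p" using K p(1) by (auto simp: clique_def)
  moreover have "card (insert v (nb v) - {p}) = card (nb p)"
    using c p by (simp add: cubic_def card_Diff_singleton)
  ultimately show "nb p = insert v (nb v) - {p}"
    using card_subset_eq[OF finite_nb] by metis
qed

text \<open>A leaf \<open>w\<close> of the forest \<open>L\<close> of violating vertices has a
  degree 3 neighbour \<open>u\<close> in \<open>D\<close> outside \<open>L\<close>, whose closed
  neighbourhood is a K4. As \<open>w\<close> has degree 3, this is also its own closed
  neighbourhood, so a second such neighbour of \<open>w\<close> would, together with
  \<open>w\<close>, put \<open>u\<close> into \<open>L\<close>.\<close>

lemma cubic_clique_degrees:
  assumes "\<And>v. v \<in> D \<Longrightarrow> v \<in> cubic \<Longrightarrow> card (nb v \<inter> cubic \<inter> D) \<le> 1 \<Longrightarrow> clique (insert v (nb v))"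
    and "v \<in> D" "v \<in> cubic"
  shows "card (nb v \<inter> cubic \<inter> D) \<le> 1"
proof (rule ccontr)
  define L where "L = {v \<in> D \<inter> cubic. 2 \<le> card (nb v \<inter> cubic \<inter> D)}"
  assume "\<not> card (nb v \<inter> cubic \<inter> D) \<le> 1"
  then have "L \<noteq> {}" using assms(2,3) unfolding L_def by force
  moreover have "L \<subseteq> cubic" by (auto simp: L_def)
  ultimately obtain w where w: "w \<in> L" "card (nb w \<inter> L) \<le> 1" using cubic_leaf by metis
  then have wD: "w \<in> D" "w \<in> cubic" and two: "2 \<le> card (nb w \<inter> cubic \<inter> D)" by (auto simp: L_def)
  have "\<not> nb w \<inter> cubic \<inter> D \<subseteq> L"
  proof
    assume "nb w \<inter> cubic \<inter> D \<subseteq> L"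
    then have "nb w \<inter> cubic \<inter> D \<subseteq> nb w \<inter> L" by auto
    from card_mono[OF _ this] show False using w(2) two by simp
  qed
  then obtain u where u: "u \<in> nb w" "u \<in> cubic" "u \<in> D" "u \<notin> L" by auto
  then have le: "card (nb u \<inter> cubic \<inter> D) \<le> 1" by (simp add: L_def)
  have K: "clique (insert u (nb u))" by (rule assms(1)[OF u(3,2) le])
  have wu: "w \<in> nb u" using u(1) nb_symD by simp
  then have nw: "nb w = insert u (nb u) - {w}" using cubic_clique(4)[OF u(2) K] wD by simp
  have "nb w \<inter> cubic \<inter> D \<subseteq> {u}"
  proof
    fix q assume q: "q \<in> nb w \<inter> cubic \<inter> D"
    show "q \<in> {u}"
    proof (rule ccontr)
      assume "q \<notin> {u}"
      then have "q \<in> nb u" "q \<noteq> w" using q nw by auto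
      then have "2 \<le> card (nb u \<inter> cubic \<inter> D)"
        using q wu wD by (intro two_le_card[of _ q w]) auto
      then show False using le by simp
    qed
  qed
  from card_mono[OF _ this] show False using two by simp
qed

lemma crossI: "p \<in> A \<Longrightarrow> p \<notin> B \<Longrightarrow> q \<in> B \<Longrightarrow> q \<notin> A \<Longrightarrow> q \<in> nb p \<Longrightarrow> {p, q} \<in> cross A B"
  by (auto simp: cross_def nb_def)

end

section \<open>Minimal fragments contain the neighbours of their degree 3 vertices\<close>

context irreducible
begin

text \<open>Here \<open>D\<close> is just \<open>{v, b, c}\<close>. The modular identity leaves a
  single edge \<open>bb'\<close> from \<open>D\<close> to the outside apart from the edges at
  \<open>a\<close>, and the tight set blocking its contraction contains \<open>v\<close>,
  \<open>b\<close>, \<open>c\<close> but not \<open>a\<close>, which is adjacent to all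
  three.\<close>

lemma min_fragment_triangle:
  assumes D: "min_fragment D" and v: "v \<in> cubic" and nbv: "nb v = {a, b, c}"
    and K: "clique (insert v (nb v))"
    and inD: "v \<in> D" "a \<notin> D" "b \<in> D" "c \<in> D" and U: "insert v (nb v) \<union> (V - D) = V"
    and b: "b \<notin> cubic"
  shows False
proof -
  let ?K = "insert v (nb v)" and ?X = "V - D"
  have ne: "a \<noteq> b" "a \<noteq> c" "b \<noteq> c" "v \<noteq> a" "v \<noteq> b" "v \<noteq> c"
    using cubic_distinct[OF v nbv] by simp_all
  have DV: "D \<subseteq> V" and X: "tight ?X" using D by (auto simp: min_fragment_def)
  have aV: "a \<in> V" and bV: "b \<in> V" using nbv nb_subset[of v] by auto
  have KD: "?K \<inter> ?X = {a}" using nbv inD aV by auto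
  have cr: "card (cross ?K ?X) = 1"
    using slack_modular[of ?K ?X] tightD[OF X] tightD[OF cubic_clique(3)[OF v K]] slack_singleton[of a] slack_V
    unfolding U KD by simp
  have Dsub: "D \<subseteq> {v, b, c}" using U nbv inD(2) DV by auto
  have bn: "v \<in> nb b" "a \<in> nb b" "c \<in> nb b"
    using K nbv ne unfolding clique_def by auto
  have cn: "v \<in> nb c" "a \<in> nb c" "b \<in> nb c"
    using K nbv ne unfolding clique_def by auto
  have "\<not> nb b \<subseteq> {v, a, c}"
  proof
    assume "nb b \<subseteq> {v, a, c}"
    from card_mono[OF _ this] have "card (nb b) \<le> 3" by (simp add: card_insert_if split: if_splits)
    then show False using not_cubic[OF bV b] by simp
  qed
  then obtain b' where b': "b' \<in> nb b" "b' \<noteq> v" "b' \<noteq> a" "b' \<noteq> c" by auto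
  have b'V: "b' \<in> V" using b' nb_subset by auto
  have b'b: "b' \<noteq> b" using b' nb_irrefl by metis
  have b'D: "b' \<notin> D" using Dsub b' b'b by auto
  have e: "{b, b'} \<in> cross ?K ?X"
    using nbv inD b' b'b b'V b'D by (intro crossI) auto
  have only: "{p, q} = {b, b'}" if "p \<in> {b, c}" "q \<in> nb p" "q \<notin> {v, a, b, c}" for p q
  proof -
    have "q \<in> V" "q \<notin> D" using that Dsub nb_subset[of p] by auto
    then have "{p, q} \<in> cross ?K ?X" using that nbv inD by (intro crossI) auto
    with cr e show ?thesis by (metis card_1_singletonE singletonD)
  qed
  have nbb: "nb b \<subseteq> {v, a, c, b'}"
  proof
    fix q assume q: "q \<in> nb b"
    then have "q \<noteq> b" using nb_irrefl by metis
    then show "q \<in> {v, a, c, b'}" using only[of b q] q by (auto simp: doubleton_eq_iff)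
  qed
  have nbc: "nb c \<subseteq> {v, a, b}"
  proof
    fix q assume q: "q \<in> nb c"
    then have "q \<noteq> c" using nb_irrefl by metis
    moreover have "{c, q} \<noteq> {b, b'}" using ne b' by (auto simp: doubleton_eq_iff)
    ultimately show "q \<in> {v, a, b}" using only[of c q] q by auto
  qed
  have b'n: "b' \<notin> nb v" "b' \<notin> nb c" using nbv nbc b' b'b by auto
  then have b'n': "v \<notin> nb b'" "c \<notin> nb b'" using nb_symD by metis+
  obtain Z where Z: "tight Z" "2 \<le> card Z" "b \<in> Z" "b' \<in> Z" "a \<notin> Z"
  proof (rule blocker[of a b b'])
    show "s = a" if "s \<in> nb b" "s \<in> nb b'" for s
      using nbb b'n' that nb_irrefl[of b'] by blast
  qed (use bn b' in auto)
  have cZ: "c \<in> Z" if "v \<in> Z"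
  proof -
    have "nb v \<inter> Z \<subseteq> {b, c}" using nbv Z(5) by auto
    then show ?thesis by (rule tight_nb_two[OF Z(1,2) that])
  qed
  have "c \<in> Z"
  proof (rule ccontr)
    assume c: "c \<notin> Z"
    then have "nb b \<inter> Z \<subseteq> {b', v}" using nbb Z(5) by auto
    then have "v \<in> Z" by (rule tight_nb_two[OF Z(1-3)])
    then show False using cZ c by simp
  qed
  moreover have "v \<in> Z"
  proof -
    have "nb c \<inter> Z \<subseteq> {v, b}" using nbc Z(5) by auto
    then show ?thesis by (rule tight_nb_two[OF Z(1,2) \<open>c \<in> Z\<close>])
  qed
  moreover have "v \<in> nb a" "b \<in> nb a" "c \<in> nb a" using nbv bn cn by (simp_all add: nb_symD)
  ultimately have "{v, b, c} \<subseteq> nb a \<inter> (Z \<inter> D)" using Z(3) inD by simp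
  from card_mono[OF _ this] have "3 \<le> card (nb a \<inter> (Z \<inter> D))" using ne by simp
  then show False using min_fragment_dominated[OF D aV inD(2) Z(1,5)] by simp
qed

text \<open>With a neighbour \<open>a\<close> outside, the K4 at \<open>v\<close> meets
  \<open>V - D\<close> only in \<open>a\<close>; unless their union is \<open>V\<close>, it is tight
  with no crossing edges. The rest of \<open>D\<close> then has degree 3 throughout, and the K4 at a
  leaf or isolated vertex of it contains an edge that would have to cross.\<close>

lemma min_fragment_nb_subset:
  assumes D: "min_fragment D" and v: "v \<in> D" "v \<in> cubic"
    and le: "card (nb v \<inter> cubic \<inter> D) \<le> 1"
  shows "nb v \<subseteq> D"
proof (rule ccontr)
  let ?K = "insert v (nb v)" and ?X = "V - D"
  assume "\<not> nb v \<subseteq> D"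
  then obtain a where a: "a \<in> nb v" "a \<notin> D" by auto
  obtain b c where nbv: "nb v = {a, b, c}" and ne: "a \<noteq> b" "a \<noteq> c" "b \<noteq> c"
    using cubic_nb_of[OF v(2) a(1)] .
  have DV: "D \<subseteq> V" and X: "tight ?X" "2 \<le> card ?X" using D by (auto simp: min_fragment_def)
  have X4: "4 \<le> card ?X" using tight_card[OF X] .
  have out: "p = q" if "w \<in> D" "w \<in> cubic" "p \<in> nb w - D" "q \<in> nb w - D" for w p q
    using two_le_card[of "nb w - D" p q] min_fragment_nb_outside[OF D that(1,2)] that by fastforce
  have bD: "b \<in> D" and cD: "c \<in> D" using out[OF v, of a b] out[OF v, of a c] a nbv ne by auto
  have K: "clique ?K" by (rule min_fragment_clique[OF D v le])
  note Kc = cubic_clique[OF v(2) K]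
  have aV: "a \<in> V" using a nb_subset by auto
  have KD: "?K \<inter> ?X = {a}" using nbv v a bD cD aV by auto
  show False
  proof (cases "?K \<union> ?X = V")
    case True
    have "D \<subseteq> {v, b, c}" using True nbv a(2) DV by auto
    moreover have "\<not> D \<subseteq> cubic" using D by (simp add: min_fragment_def)
    ultimately have "b \<notin> cubic \<or> c \<notin> cubic" using v by auto
    moreover have "nb v = {a, c, b}" using nbv by auto
    ultimately show False
      using min_fragment_triangle[OF D v(2) _ K v(1) a(2) _ _ True] nbv bD cD by metis
  next
    case False
    have KX: "tight (?K \<union> ?X)" "cross ?K ?X = {}"
      using tight_Un_Int[OF Kc(3) X(1) _ False] KD by auto
    let ?T = "D - ?K"
    have "V - ?T = ?K \<union> ?X" using DV Kc(2) by auto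
    moreover have "?T \<noteq> {}" using False DV Kc(2) by auto
    moreover have "?T \<subset> D" using v by auto
    ultimately have T: "?T \<subseteq> cubic" "?T \<noteq> {}"
      using D KX(1) unfolding min_fragment_def by metis+
    obtain p where p: "p \<in> ?T" "card (nb p \<inter> ?T) \<le> 1" using cubic_leaf[OF T] .
    then have pD: "p \<in> D" "p \<in> cubic" "p \<notin> ?K" using T by auto
    have "nb p \<inter> cubic \<inter> D \<subseteq> nb p \<inter> ?T"
    proof
      fix q assume q: "q \<in> nb p \<inter> cubic \<inter> D"
      have "q \<notin> ?K"
      proof
        assume "q \<in> ?K"
        then have "nb q = ?K - {q}" using Kc(4)[of q] q by blast
        moreover have "p \<in> nb q" using q by (simp add: nb_symD)
        ultimately show False using pD by blast
      qed
      then show "q \<in> nb p \<inter> ?T" using q by auto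
    qed
    from card_mono[OF _ this] have lep: "card (nb p \<inter> cubic \<inter> D) \<le> 1" using p(2) by simp
    let ?P = "insert p (nb p)"
    have P: "clique ?P" by (rule min_fragment_clique[OF D pD(1,2) lep])
    note Pc = cubic_clique[OF pD(2) P]
    have outp: "card (nb p - D) \<le> 1" by (rule min_fragment_nb_outside[OF D pD(1,2)])
    \<comment> \<open>The tight set \<open>V - D\<close> has at least four vertices, while the two
      cliques reach at most two of them.\<close>
    have KP_ne: "?K \<union> ?P \<noteq> V"
    proof
      assume "?K \<union> ?P = V"
      then have "?X \<subseteq> insert a (nb p - D)" using nbv v bD cD pD by auto
      from card_mono[OF _ this] have "card ?X \<le> 2"
        using outp by (simp add: card_insert_if split: if_splits)
      then show False using X4 by simp
    qed
    have KP: "s = t" if st: "s \<in> ?K \<inter> ?P" "t \<in> ?K \<inter> ?P" for s t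
    proof (rule ccontr)
      assume "s \<noteq> t"
      then have "2 \<le> card (?K \<inter> ?P)" using st by (intro two_le_card) auto
      moreover have "tight (?K \<inter> ?P)" using tight_Un_Int(2)[OF Kc(3) Pc(3) _ KP_ne] st by auto
      ultimately have "4 \<le> card (?K \<inter> ?P)" using tight_card by blast
      then have "?K \<inter> ?P = ?P" using Pc(1) by (intro card_seteq) auto
      then show False using pD(3) by blast
    qed
    have vp: "v \<notin> nb p" using pD(3) nb_symD[of v p] by blast
    \<comment> \<open>At most one neighbour of \<open>p\<close> lies in each of
      \<open>D - ?K\<close>, \<open>{b, c}\<close> and the outside of \<open>D\<close>, so each
      occurs; the last two span the forbidden crossing edge.\<close>
    have "nb p \<subseteq> (nb p \<inter> ?T) \<union> (nb p \<inter> {b, c}) \<union> (nb p - D)"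
      using nbv a vp by auto
    from card_mono[OF _ this] have "3 \<le> card ((nb p \<inter> ?T) \<union> (nb p \<inter> {b, c}) \<union> (nb p - D))"
      using pD(2) by (simp add: cubic_def)
    also have "\<dots> \<le> card (nb p \<inter> ?T) + card (nb p \<inter> {b, c}) + card (nb p - D)"
      by (meson add_le_mono1 card_Un_le le_trans)
    finally have sum3: "3 \<le> card (nb p \<inter> ?T) + card (nb p \<inter> {b, c}) + card (nb p - D)" .
    have "card (nb p \<inter> {b, c}) \<le> 1"
    proof (rule ccontr)
      assume "\<not> ?thesis"
      then obtain s t where "s \<in> nb p \<inter> {b, c}" "t \<in> nb p \<inter> {b, c}" "s \<noteq> t"
        by (metis One_nat_def card_le_Suc0_iff_eq finite_Int finite_nb)
      then show False using KP[of s t] nbv by auto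
    qed
    then have "card (nb p \<inter> {b, c}) \<noteq> 0" "card (nb p - D) \<noteq> 0"
      using sum3 p(2) outp by linarith+
    then have "nb p \<inter> {b, c} \<noteq> {}" "nb p - D \<noteq> {}" by (metis card.empty)+
    then obtain s t where s: "s \<in> nb p" "s \<in> {b, c}" and t: "t \<in> nb p" "t \<notin> D" by auto
    have sK: "s \<in> ?K" "s \<in> D" using s nbv bD cD by auto
    have st: "s \<noteq> t" using sK t by auto
    have "t \<notin> ?K" using KP[of s t] s t sK st by auto
    moreover have "t \<in> nb s" using P s t st unfolding clique_def by auto
    moreover have "t \<in> V" using t nb_subset by auto
    ultimately have "{s, t} \<in> cross ?K ?X" using sK t by (intro crossI) auto
    then show False using KX(2) by simp
  qed
qed

end

context circuit
begin

section \<open>Excluding fragments\<close>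

lemma min_fragment_exists:
  assumes "tight Z" "2 \<le> card Z" "b \<in> V - Z" "b \<notin> cubic"
  obtains D where "min_fragment D"
proof -
  define P where "P D \<longleftrightarrow> D \<subseteq> V \<and> tight (V - D) \<and> 2 \<le> card (V - D) \<and> \<not> D \<subseteq> cubic" for D
  have "V - (V - Z) = Z" using tightD(1)[OF assms(1)] by auto
  then have "P (V - Z)" using assms by (auto simp: P_def)
  then obtain D where D: "P D" "\<And>D'. P D' \<Longrightarrow> card D \<le> card D'"
    using ex_has_least_nat[of P "V - Z" card] by blast
  have "D' \<subseteq> cubic" if D': "D' \<subset> D" "tight (V - D')" for D'
  proof (rule ccontr)
    assume nc: "\<not> D' \<subseteq> cubic"
    have "card (V - D) \<le> card (V - D')"
      by (rule card_mono) (use D' finite_V in auto)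
    then have "P D'" using D' D(1) nc by (auto simp: P_def)
    then have "card D \<le> card D'" by (rule D(2))
    moreover have "card D' < card D"
      using D' D(1) finite_sub by (intro psubset_card_mono) (auto simp: P_def)
    ultimately show False by simp
  qed
  then have "min_fragment D" using D(1) unfolding P_def min_fragment_def by blast
  then show thesis by (rule that)
qed

end

context irreducible
begin

lemma min_fragment_cubic:
  assumes D: "min_fragment D" and v: "v \<in> D" "v \<in> cubic"
  shows "card (nb v \<inter> cubic \<inter> D) \<le> 1" "nb v \<subseteq> D" "clique (insert v (nb v))"
proof -
  show le: "card (nb v \<inter> cubic \<inter> D) \<le> 1"
    using cubic_clique_degrees[OF min_fragment_clique[OF D] v] .
  show "nb v \<subseteq> D" by (rule min_fragment_nb_subset[OF D v le])
  show "clique (insert v (nb v))" by (rule min_fragment_clique[OF D v le])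
qed

text \<open>Three edges leave \<open>D\<close>. Contracting one of them, \<open>pp'\<close> with
  \<open>p\<close> of degree 4, while deleting an edge from \<open>p\<close> to some
  \<open>r\<close> of degree at least 4 can fail only through a second triangle, so
  \<open>p'\<close> is also adjacent to the remaining vertex \<open>s\<close>. This gives
  \<open>p'\<close> too many neighbours in \<open>D\<close>, or \<open>s\<close> more than three
  neighbours.\<close>

lemma min_fragment_not_K4:
  assumes D: "min_fragment D" and v: "v \<in> cubic" "D = insert v (nb v)"
  shows False
proof -
  have vD: "v \<in> D" using v by simp
  have DV: "D \<subseteq> V" and X: "tight (V - D)" "2 \<le> card (V - D)"
    using D by (auto simp: min_fragment_def)
  note le = min_fragment_cubic(1)[OF D vD v(1)]
  have K: "clique D" using min_fragment_cubic(3)[OF D vD v(1)] v by simp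
  note Kc = cubic_clique[OF v(1), folded v(2), OF K]
  have contract: "p' \<in> nb s"
    if prs: "nb v = {p, r, s}" "card (nb p) = 4" "r \<notin> cubic" "p' \<in> nb p" "p' \<notin> D" for p r s p'
  proof (rule ccontr)
    assume s: "p' \<notin> nb s"
    note ne = cubic_distinct[OF v(1) prs(1)]
    have pn: "v \<in> nb p" "r \<in> nb p" "s \<in> nb p"
      using K ne unfolding clique_def v(2) prs(1) by auto
    have p': "p' \<noteq> v" "p' \<noteq> r" "p' \<noteq> s" using prs(5) unfolding v(2) prs(1) by auto
    have "{v, r, s, p'} = nb p"
      using pn prs(4) ne p' prs(2) by (intro card_subset_eq) auto
    moreover have "v \<notin> nb p'" "s \<notin> nb p'"
      using s prs(5) nb_symD[of v p'] nb_symD[of s p'] unfolding v(2) by auto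
    ultimately have tri: "t = r" if "t \<in> nb p" "t \<in> nb p'" for t
    proof -
      have "t \<in> {v, r, s, p'}" using \<open>{v, r, s, p'} = nb p\<close> that(1) by simp
      then show ?thesis
        using that(2) \<open>v \<notin> nb p'\<close> \<open>s \<notin> nb p'\<close> nb_irrefl[of p'] by auto
    qed
    obtain Z where Z: "tight Z" "2 \<le> card Z" "p \<in> Z" "p' \<in> Z" "r \<notin> Z"
      by (rule blocker[OF pn(2) prs(4) p'(2)[symmetric] tri])
    have "p \<in> D" "r \<in> D" using v(2) prs(1) by auto
    then show False using min_fragment_meet[OF D Z(1,4) prs(5) Z(3) _ _ Z(5)] prs(3) by blast
  qed
  have outer: "\<exists>p'. p' \<in> nb p \<and> p' \<notin> D" if "p \<in> D" "card (nb p) = 4" for p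
  proof (rule ccontr)
    assume "\<not> ?thesis"
    then have "nb p \<subseteq> D - {p}" using nb_irrefl[of p] by blast
    from card_mono[OF _ this] show False
      using that Kc(1) tightD(4)[OF Kc(3)] by simp
  qed
  have "slack (V - D) = 0" "slack D = 0" using tightD(5) X(1) Kc(3) by auto
  \<comment> \<open>Six edges inside, \<open>2 * 4 + 1\<close>, and slack \<open>0\<close> of the
    complement.\<close>
  then have sumD: "(\<Sum>w\<in>D. int (card (nb w))) = 15"
    using sum_degrees[OF DV] Kc(1) by (simp add: slack_def)
  have sum3: "card (nb p) + card (nb r) + card (nb s) = 12" if "nb v = {p, r, s}" for p r s
  proof -
    have "D = {v, p, r, s}" using v(2) that by simp
    with sumD cubic_distinct[OF v(1) that]
    have "int (card (nb v)) + (int (card (nb p)) + (int (card (nb r)) + int (card (nb s)))) = 15"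
      by simp
    moreover have "card (nb v) = 3" using v(1) by (simp add: cubic_def)
    ultimately show ?thesis by linarith
  qed
  show False
  proof (cases "nb v \<inter> cubic = {}")
    case True
    obtain a b c where abc: "nb v = {a, b, c}" using cubic_nb[OF v(1)] .
    note ne = cubic_distinct[OF v(1) abc]
    have inV: "a \<in> V" "b \<in> V" "c \<in> V" using abc nb_subset[of v] by auto
    have nc: "a \<notin> cubic" "b \<notin> cubic" "c \<notin> cubic" using True abc by auto
    then have "4 \<le> card (nb a)" "4 \<le> card (nb b)" "4 \<le> card (nb c)"
      using not_cubic inV by auto
    then have four: "card (nb a) = 4" "card (nb b) = 4" "card (nb c) = 4"
      using sum3[OF abc] by linarith+
    have inD: "a \<in> D" "b \<in> D" "c \<in> D" using abc v(2) by auto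
    obtain a' where a': "a' \<in> nb a" "a' \<notin> D" using outer[OF inD(1) four(1)] by blast
    have "nb v = {a, b, c}" "nb v = {a, c, b}" using abc by auto
    then have "a' \<in> nb c" "a' \<in> nb b"
      using contract[of a b c a'] contract[of a c b a'] four(1) nc a' by blast+
    then have "{a, b, c} \<subseteq> nb a' \<inter> D" using a' inD by (simp add: nb_symD)
    from card_mono[OF _ this] have "3 \<le> card (nb a' \<inter> D)" using ne by simp
    moreover have a'V: "a' \<in> V" using a' nb_subset by auto
    ultimately have "insert a' D = V" using tight_outside[OF Kc(3) a'V a'(2)] by linarith
    then have "V - D \<subseteq> {a'}" by auto
    from card_mono[OF _ this] show False using X(2) by simp
  next
    case False
    then obtain s where s: "s \<in> nb v" "s \<in> cubic" by auto
    obtain p r where prs: "nb v = {s, p, r}" "s \<noteq> p" "s \<noteq> r" "p \<noteq> r" using cubic_nb_of[OF v(1) s(1)] .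
    have inD: "s \<in> D" "p \<in> D" "r \<in> D" using prs v(2) by auto
    have notc: "q \<notin> cubic" if "q \<in> nb v" "q \<noteq> s" for q
    proof
      assume "q \<in> cubic"
      then have "2 \<le> card (nb v \<inter> cubic \<inter> D)"
        using that s v(2) by (intro two_le_card[of _ q s]) auto
      then show False using le by simp
    qed
    have nc: "p \<notin> cubic" "r \<notin> cubic" using notc prs by auto
    have "4 \<le> card (nb p)" "4 \<le> card (nb r)" using not_cubic nc inD DV by auto
    moreover have "card (nb s) = 3" using s(2) by (simp add: cubic_def)
    ultimately have "card (nb p) = 4 \<or> card (nb r) = 4" using sum3[OF prs(1)] by linarith
    then have "\<exists>q\<in>{p, r}. card (nb q) = 4" by auto
    then obtain q where q: "q \<in> {p, r}" "card (nb q) = 4" by blast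
    then obtain q' where q': "q' \<in> nb q" "q' \<notin> D" using outer[of q] inD by blast
    have "nb v = {p, r, s}" "nb v = {r, p, s}" using prs by auto
    then have "q' \<in> nb s"
      using contract[of p r s q'] contract[of r p s q'] q q' nc by blast
    moreover have "nb s = D - {s}" using Kc(4) inD(1) s(2) by blast
    ultimately show False using q' by simp
  qed
qed

text \<open>If both sets are proper, each meets at most one of the three edges between \<open>V - D\<close> and \<open>D\<close>: a proper
  tight subset meeting two of them leaves vertices of degree 3 in \<open>D\<close>, and the third edge has no end.\<close>

lemma min_fragment_tight_Un:
  assumes D: "min_fragment D" and A: "tight A" "tight B" "A \<inter> B \<noteq> {}"
    and U: "A \<union> B = D"
  shows "A = D \<or> B = D"
proof (rule ccontr)
  assume neq: "\<not> (A = D \<or> B = D)"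
  let ?X = "V - D"
  have DV: "D \<subseteq> V" and X: "tight ?X" using D by (auto simp: min_fragment_def)
  \<comment> \<open>The constant \<open>2\<close> is minus the slack of the empty
    intersection.\<close>
  have slack_join: "slack (?X \<union> S) = 2 - int (card (cross ?X S))" if "tight S" "S \<subseteq> D" for S
  proof -
    have "?X \<inter> S = {}" using that by auto
    then show ?thesis
      using slack_modular[of ?X S] tightD[OF X] tightD[OF that(1)] by (simp add: slack_def[of "{}"])
  qed
  have "D \<noteq> V" using tightD(3)[OF X] DV by auto
  then have tD: "tight D" using tight_Un_Int(1)[OF A] U by simp
  have "?X \<union> D = V" using DV by auto
  then have c3: "card (cross ?X D) = 3" using slack_join[OF tD] slack_V by simp
  have small: "card (cross ?X S) \<le> 1" if S: "tight S" "S \<subset> D" for S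
  proof (rule ccontr)
    assume "\<not> ?thesis"
    then have "slack (?X \<union> S) \<le> 0" using slack_join[OF S(1)] S(2) by auto
    moreover have "?X \<union> S \<subset> V" "?X \<union> S \<noteq> {}" using S DV tightD(3)[OF S(1)] by auto
    ultimately have "tight (?X \<union> S)" "slack (?X \<union> S) = 0"
      using slack_nonneg[of "?X \<union> S"] by (auto simp: tight_def)
    moreover have "?X \<union> S = V - (D - S)" using S DV by auto
    moreover have "D - S \<subset> D" "D - S \<noteq> {}" using S tightD(3)[OF S(1)] by auto
    ultimately have cub: "D - S \<subseteq> cubic" using D unfolding min_fragment_def by metis
    have "cross ?X D \<subseteq> cross ?X S"
    proof
      fix e assume "e \<in> cross ?X D"
      then obtain p q where pq: "p \<in> V - D" "q \<in> D" "e = {p, q}" "e \<in> E"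
        by (auto simp: cross_def)
      then have "p \<in> nb q" by (simp add: nb_def insert_commute)
      then have "q \<in> S" using min_fragment_cubic(2)[OF D pq(2)] cub pq(1,2) by blast
      then show "e \<in> cross ?X S" using pq S by (auto simp: cross_def)
    qed
    from card_mono[OF finite_cross this] have "3 \<le> card (cross ?X S)" using c3 by simp
    moreover have "card (cross ?X S) = 2"
      using slack_join[OF S(1)] S(2) \<open>slack (?X \<union> S) = 0\<close> by simp
    ultimately show False by simp
  qed
  have "cross ?X D \<subseteq> cross ?X A \<union> cross ?X B" using U by (auto simp: cross_def)
  from card_mono[OF _ this] have "3 \<le> card (cross ?X A \<union> cross ?X B)"
    using c3 finite_cross by simp
  also have "\<dots> \<le> card (cross ?X A) + card (cross ?X B)" by (rule card_Un_le)
  finally have "3 \<le> card (cross ?X A) + card (cross ?X B)" .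
  moreover have "A \<subset> D" "B \<subset> D" using neq U by blast+
  ultimately show False using small[OF A(1)] small[OF A(2)] by simp
qed

text \<open>The maximal tight proper subsets of \<open>D\<close> partition it. A degree count finds
  one, \<open>T\<close>, with tight complement; by minimality it consists of degree 3 vertices and,
  inducing a forest, is a single vertex. The K4 around that vertex is tight, so by maximality it is
  \<open>D\<close>.\<close>

lemma no_min_fragment: "\<not> min_fragment D"
proof
  assume D: "min_fragment D"
  have DV: "D \<subseteq> V" and X: "tight (V - D)" and nc: "\<not> D \<subseteq> cubic"
    using D by (auto simp: min_fragment_def)
  have fD: "finite D" using DV finite_sub by blast
  have D_ne: "D \<noteq> V" using tightD(3)[OF X] DV by auto
  have D0: "D \<noteq> {}" using nc by auto
  define \<A> where "\<A> = {T. T \<subset> D \<and> tight T}"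
  define M where "M = {T \<in> \<A>. \<forall>T'\<in>\<A>. T \<subseteq> T' \<longrightarrow> T = T'}"
  have fA: "finite \<A>" by (rule finite_subset[of _ "Pow D"]) (use fD in \<open>auto simp: \<A>_def\<close>)
  have cover: "\<Union>M = D"
  proof
    show "\<Union>M \<subseteq> D" by (auto simp: M_def \<A>_def)
    show "D \<subseteq> \<Union>M"
    proof
      fix v assume v: "v \<in> D"
      have "{v} \<noteq> D"
      proof
        assume vD: "{v} = D"
        then have "tight (V - {v})" "v \<in> V" using X v DV by auto
        then show False using tight_remove_cubic nc vD by auto
      qed
      then have "{v} \<in> \<A>" using v DV by (auto simp: \<A>_def tight_def slack_singleton)
      then obtain T where "T \<in> \<A>" "{v} \<subseteq> T" "\<forall>T'\<in>\<A>. T \<subseteq> T' \<longrightarrow> T = T'"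
        using finite_has_maximal2[OF fA] by metis
      then show "v \<in> \<Union>M" by (auto simp: M_def)
    qed
  qed
  have disj: "A \<inter> B = {}" if AB: "A \<in> M" "B \<in> M" "A \<noteq> B" for A B
  proof (rule ccontr)
    assume ne: "A \<inter> B \<noteq> {}"
    have A: "A \<subset> D" "tight A" and B: "B \<subset> D" "tight B"
      and max: "\<And>T. T \<subset> D \<Longrightarrow> tight T \<Longrightarrow> A \<subseteq> T \<Longrightarrow> A = T"
        "\<And>T. T \<subset> D \<Longrightarrow> tight T \<Longrightarrow> B \<subseteq> T \<Longrightarrow> B = T"
      using AB by (auto simp: M_def \<A>_def)
    have "A \<union> B \<noteq> V" using A B DV D_ne by blast
    then have t: "tight (A \<union> B)" using tight_Un_Int(1)[OF A(2) B(2) ne] by simp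
    have "A \<union> B = D"
    proof (rule ccontr)
      assume "A \<union> B \<noteq> D"
      then have "A \<union> B \<subset> D" using A B by auto
      then have "A = A \<union> B" "B = A \<union> B" using max t by blast+
      then show False using AB(3) by simp
    qed
    then show False using min_fragment_tight_Un[OF D A(2) B(2) ne] A B by auto
  qed
  \<comment> \<open>Otherwise the average degree in each \<open>T\<close>, hence in \<open>D\<close>, is at least 4.\<close>
  have "\<exists>T\<in>M. slack (V - T) \<le> 0"
  proof (rule ccontr)
    assume "\<not> ?thesis"
    then have pos: "1 \<le> slack (V - T)" if "T \<in> M" for T using that by force
    have "0 \<le> (\<Sum>v\<in>T. int (card (nb v)) - 4)" if T: "T \<in> M" for T
    proof -
      have tT: "tight T" using T by (simp add: M_def \<A>_def)
      show ?thesis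
        using sum_degrees[OF tightD(1)[OF tT]] tightD(5)[OF tT] pos[OF T]
        by (simp add: sum_subtractf slack_def[of T])
    qed
    then have "0 \<le> (\<Sum>T\<in>M. \<Sum>v\<in>T. int (card (nb v)) - 4)" by (rule sum_nonneg)
    also have "\<dots> = (\<Sum>v\<in>\<Union>M. int (card (nb v)) - 4)"
      using sum.Union_disjoint[of M "\<lambda>v. int (card (nb v)) - 4"] disj fD cover
      by (metis (no_types, lifting) Union_upper comp_apply rev_finite_subset sum.cong)
    also have "\<dots> = (\<Sum>v\<in>D. int (card (nb v))) - 4 * int (card D)"
      using cover by (simp add: sum_subtractf)
    \<comment> \<open>As \<open>V - D\<close> is tight, the degree sum over \<open>D\<close> is
      \<open>edges_in D + 2 * card D + 1\<close>, which is at most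
      \<open>4 * card D - 1\<close>.\<close>
    finally have "4 * int (card D) \<le> edges_in D + 2 * int (card D) + 1"
      using sum_degrees[OF DV] tightD(5)[OF X] by simp
    moreover have "0 \<le> slack D" using DV D_ne D0 by (intro slack_nonneg) auto
    ultimately show False by (simp add: slack_def)
  qed
  then obtain T where T: "T \<in> M" "slack (V - T) \<le> 0" by blast
  have TD: "T \<subset> D" "tight T" and max: "\<And>T'. T' \<subset> D \<Longrightarrow> tight T' \<Longrightarrow> T \<subseteq> T' \<Longrightarrow> T = T'"
    using T(1) by (auto simp: M_def \<A>_def)
  have T0: "T \<noteq> {}" using tightD(3)[OF TD(2)] .
  have VT: "V - T \<subset> V" "V - T \<noteq> {}" using TD T0 DV by auto
  then have "tight (V - T)" using slack_nonneg[OF VT] T(2) by (auto simp: tight_def)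
  then have Tc: "T \<subseteq> cubic" using D TD(1) T0 unfolding min_fragment_def by metis
  then obtain v where v: "v \<in> T" "card (nb v \<inter> T) \<le> 1" using cubic_leaf[OF _ T0] by metis
  have vD: "v \<in> D" "v \<in> cubic" using v Tc TD by auto
  have T1: "card T < 2" using tight_nb[OF TD(2) _ v(1)] v(2) by fastforce
  note K = min_fragment_cubic[OF D vD]
  note Kc = cubic_clique[OF vD(2) K(3)]
  have TK: "T \<subseteq> insert v (nb v)"
  proof
    fix w assume "w \<in> T"
    then show "w \<in> insert v (nb v)"
      using two_le_card[OF tightD(4)[OF TD(2)], of v w] v(1) T1 by auto
  qed
  have "insert v (nb v) \<noteq> T" using Kc(1) T1 by auto
  then have "\<not> insert v (nb v) \<subset> D" using max[OF _ Kc(3) TK] by auto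
  then have "D = insert v (nb v)" using K(2) vD by auto
  then show False using min_fragment_not_K4[OF D vD(2)] by simp
qed

section \<open>The leaf argument on the whole vertex set\<close>

lemma confined_V: "confined V"
proof -
  \<comment> \<open>For \<open>D = V\<close> the conclusion in \<open>confined\<close> includes
    \<open>V \<noteq> V\<close>, so it amounts to the absence of such tight sets.\<close>
  have False if "tight Z" "2 \<le> card Z" "b \<in> V - Z" "b \<notin> cubic" for Z b
    using min_fragment_exists[OF that] no_min_fragment by blast
  then show ?thesis by (auto simp: confined_def)
qed

lemma cubic_V:
  assumes v: "v \<in> cubic"
  shows "card (nb v \<inter> cubic) \<le> 1" "clique (insert v (nb v))"
proof -
  have V: "v \<in> V" using v cubic_subset by auto
  have c: "nb w \<inter> cubic \<inter> V = nb w \<inter> cubic" for w using cubic_subset by auto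
  have cl: "clique (insert w (nb w))" if "w \<in> V" "w \<in> cubic" "card (nb w \<inter> cubic \<inter> V) \<le> 1" for w
    by (rule confined_clique[OF confined_V that(1,2) nb_subset that(3)])
  have le: "card (nb v \<inter> cubic \<inter> V) \<le> 1"
    by (rule cubic_clique_degrees[OF cl V v])
  then show "card (nb v \<inter> cubic) \<le> 1" unfolding c .
  show "clique (insert v (nb v))" by (rule cl[OF V v le])
qed

text \<open>The degree sum \<open>4 * card V - 2\<close> is too small for minimum degree 4.\<close>

lemma cubic_exists: obtains v where "v \<in> cubic"
proof -
  have "cubic \<noteq> {}"
  proof
    assume "cubic = {}"
    then have "4 \<le> int (card (nb v))" if "v \<in> V" for v using not_cubic[OF that] by auto
    then have "int (card V) * 4 \<le> (\<Sum>v\<in>V. int (card (nb v)))" by (rule sum_bounded_below)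
    then show False using sum_degrees[OF order_refl] edges_in_V card_E by (simp add: slack_def)
  qed
  then show thesis using that by blast
qed

text \<open>Outside the tight K4 at \<open>v\<close> all vertices have degree 3. For
  \<open>p\<close> there, at most one neighbour has degree 3, so its K4 shares at least two vertices
  with the first. Were the union not \<open>V\<close>, the intersection would be tight with at least
  four vertices and the cliques would coincide.\<close>

lemma two_cliques:
  obtains v p where "v \<in> cubic" "p \<in> cubic" "p \<notin> nb v" "p \<noteq> v"
    "insert v (nb v) \<union> insert p (nb p) = V" "card (insert p (nb p) - insert v (nb v)) \<le> 2"
proof -
  obtain v where v: "v \<in> cubic" by (rule cubic_exists)
  let ?K = "insert v (nb v)"
  note Kc = cubic_clique[OF v cubic_V(2)[OF v]]
  have T: "q \<in> cubic" if "q \<in> V - ?K" for q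
  proof (rule ccontr)
    assume "q \<notin> cubic"
    with that Kc(1) obtain D where "min_fragment D"
      using min_fragment_exists[OF Kc(3), of q] by auto
    then show False using no_min_fragment by simp
  qed
  have "?K \<noteq> V" using tightD(2)[OF Kc(3)] .
  then obtain p where p: "p \<in> V - ?K" using Kc(2) by auto
  have pc: "p \<in> cubic" using T p by blast
  let ?P = "insert p (nb p)"
  note Pc = cubic_clique[OF pc cubic_V(2)[OF pc]]
  have "?P - ?K - {p} \<subseteq> nb p \<inter> cubic" using T Pc(2) by auto
  from card_mono[OF _ this] have "card (?P - ?K - {p}) \<le> 1" using cubic_V(1)[OF pc] by simp
  moreover have "p \<in> ?P - ?K" using p by auto
  ultimately have le: "card (?P - ?K) \<le> 2" by (simp add: card_Diff_singleton)
  have "?K \<union> ?P = V"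
  proof (rule ccontr)
    assume ne: "?K \<union> ?P \<noteq> V"
    have "card ?P = card (?P - ?K) + card (?K \<inter> ?P)"
      using card_Int_Diff[of ?P ?K] by (simp add: Int_commute)
    then have two: "2 \<le> card (?K \<inter> ?P)" using Pc(1) le by linarith
    then have "?K \<inter> ?P \<noteq> {}" by (metis card.empty not_numeral_le_zero)
    then have "tight (?K \<inter> ?P)" using tight_Un_Int(2)[OF Kc(3) Pc(3) _ ne] by simp
    then have "4 \<le> card (?K \<inter> ?P)" using two tight_card by blast
    then have "?K \<inter> ?P = ?P" using Pc(1) by (intro card_seteq) auto
    then show False using p by blast
  qed
  then show thesis using that[OF v pc _ _ _ le] p by auto
qed

end

section \<open>The exceptional graphs\<close>

lemma complete_edges_image:
  assumes "inj_on g S"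
  shows "(`) g ` complete_edges S = complete_edges (g ` S)"
proof (intro equalityI subsetI)
  fix e assume "e \<in> (`) g ` complete_edges S"
  then obtain e0 where e0: "e = g ` e0" "e0 \<subseteq> S" "card e0 = 2" by (auto simp: complete_edges_def)
  then show "e \<in> complete_edges (g ` S)"
    using card_image[OF inj_on_subset[OF assms e0(2)]] by (auto simp: complete_edges_def)
next
  fix e assume "e \<in> complete_edges (g ` S)"
  then have e: "e \<subseteq> g ` S" "card e = 2" by (auto simp: complete_edges_def)
  then obtain e0 where e0: "e0 \<subseteq> S" "e = g ` e0" by (auto simp: subset_image_iff)
  then have "card e0 = 2" using e(2) card_image[OF inj_on_subset[OF assms e0(1)]] by simp
  then show "e \<in> (`) g ` complete_edges S" using e0 by (auto simp: complete_edges_def)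
qed

context circuit
begin

lemma clique_complete_edges:
  assumes "clique K" shows "complete_edges K \<subseteq> E"
proof
  fix e assume "e \<in> complete_edges K"
  then obtain p q where "e = {p, q}" "p \<noteq> q" "p \<in> K" "q \<in> K"
    by (auto simp: complete_edges_def card_2_iff)
  then show "e \<in> E" using assms by (auto simp: clique_def nb_def)
qed

lemma isomorphic_K5_minus_e:
  assumes nb: "nb v = {a, b, c}" "nb p = {a, b, c}" and V: "V = {v, p, a, b, c}"
    and dist: "distinct [v, p, a, b, c]" and K: "clique (insert v (nb v))"
  shows "isomorphic (V, E) K5_minus_e"
proof -
  have "e \<in> E \<longleftrightarrow> e \<in> complete_edges V - {{v, p}}" for e
  proof
    assume e: "e \<in> E"
    have "{v, p} \<notin> E" using nb(1) dist nb_iff[of p v] by auto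
    then show "e \<in> complete_edges V - {{v, p}}"
      using e edge_subset[OF e] edge_card[OF e] by (auto simp: complete_edges_def)
  next
    assume e: "e \<in> complete_edges V - {{v, p}}"
    show "e \<in> E"
    proof (cases "p \<in> e")
      case False
      then have "e \<in> complete_edges (insert v (nb v))"
        using e unfolding complete_edges_def V nb(1) by auto
      then show ?thesis using clique_complete_edges[OF K] by blast
    next
      case True
      obtain x y where xy: "e = {x, y}" "x \<noteq> y" using e by (auto simp: complete_edges_def card_2_iff)
      then obtain q where q: "e = {p, q}" "p \<noteq> q" using True by auto
      then have "q \<in> nb p" using e unfolding complete_edges_def V nb(2) by auto
      then show ?thesis using q by (simp add: nb_def)
    qed
  qed
  then have E: "E = complete_edges V - {{v, p}}" by blast
  \<comment> \<open>The labels \<open>0\<close> and \<open>1\<close> go to the nonadjacent pair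
    \<open>v\<close>, \<open>p\<close>, matching the edge removed in
    \<open>K5_minus_e\<close>.\<close>
  define g :: "'a \<Rightarrow> nat" where
    "g x = (if x = v then 0 else if x = p then 1 else if x = a then 2 else if x = b then 3 else 4)" for x
  have gV: "g ` V = {0, 1, 2, 3, 4}" using dist by (auto simp: V g_def)
  have inj: "inj_on g V" using dist by (auto simp: V g_def inj_on_def)
  have "(`) g ` E = (`) g ` complete_edges V - (`) g ` {{v, p}}"
    unfolding E
    by (rule inj_on_image_set_diff[OF inj_on_image_Pow[OF inj]]) (auto simp: complete_edges_def V)
  also have "(`) g ` {{v, p}} = {{0, 1}}" using dist by (auto simp: g_def)
  finally have "(`) g ` E = edges K5_minus_e"
    by (simp add: complete_edges_image[OF inj] gV K5_minus_e_def)
  moreover have "bij_betw g V (verts K5_minus_e)"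
    using inj gV by (simp add: bij_betw_def K5_minus_e_def)
  ultimately show ?thesis unfolding isomorphic_def by auto
qed

text \<open>Since \<open>{a, b}\<close> has slack \<open>1\<close> and \<open>V\<close> has slack
  \<open>-1\<close>, the modular identity for the two tight cliques leaves no crossing edge.\<close>

lemma isomorphic_H1:
  assumes V: "V = {a, b, v, c, p, q}" and dist: "distinct [a, b, v, c, p, q]"
    and K: "clique {a, b, v, c}" and P: "clique {a, b, p, q}"
  shows "isomorphic (V, E) H1"
proof -
  let ?K = "{a, b, v, c}" and ?P = "{a, b, p, q}"
  have "tight ?K" "tight ?P" using clique_tight[OF K] clique_tight[OF P] V dist by auto
  then have "card (cross ?K ?P) = 0"
  proof -
    assume t: "tight ?K" "tight ?P"
    have U: "?K \<union> ?P = V" using V by auto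
    have I: "?K \<inter> ?P = {a, b}" using dist by auto
    have "b \<in> nb a" using K dist by (auto simp: clique_def)
    then have "slack {a, b} = 1"
      using slack_insert[of "{b}" a] slack_singleton[of b] dist by simp
    then show ?thesis
      using slack_modular[of ?K ?P] tightD(5)[OF t(1)] tightD(5)[OF t(2)] slack_V unfolding U I by simp
  qed
  then have cr: "cross ?K ?P = {}" using finite_cross by simp
  have E: "E = complete_edges ?K \<union> complete_edges ?P"
  proof
    show "complete_edges ?K \<union> complete_edges ?P \<subseteq> E"
      using clique_complete_edges K P by simp
    show "E \<subseteq> complete_edges ?K \<union> complete_edges ?P"
    proof
      fix e assume e: "e \<in> E"
      then obtain x y where xy: "e = {x, y}" "y \<in> nb x" "x \<in> V" "y \<in> V" by (rule edge_cases)
      have "{x, y} \<subseteq> ?K \<or> {x, y} \<subseteq> ?P"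
      proof (rule ccontr)
        assume n: "\<not> ?thesis"
        have "x \<in> ?K \<union> ?P" "y \<in> ?K \<union> ?P" using xy unfolding V by auto
        with n have "x \<in> ?K \<and> x \<notin> ?P \<and> y \<in> ?P \<and> y \<notin> ?K \<or> y \<in> ?K \<and> y \<notin> ?P \<and> x \<in> ?P \<and> x \<notin> ?K"
          by blast
        then have "{x, y} \<in> cross ?K ?P \<or> {y, x} \<in> cross ?K ?P"
          using crossI[of x ?K ?P y] crossI[of y ?K ?P x] xy(2) nb_symD[OF xy(2)] by blast
        then show False using cr by simp
      qed
      then show "e \<in> complete_edges ?K \<union> complete_edges ?P"
        using edge_card[OF e] xy(1) by (auto simp: complete_edges_def)
    qed
  qed
  define g :: "'a \<Rightarrow> nat" where
    "g x = (if x = a then 0 else if x = b then 1 else if x = v then 2 else if x = c then 3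
      else if x = p then 4 else 5)" for x
  have gV: "g ` V = {0, 1, 2, 3, 4, 5}" using dist by (auto simp: V g_def)
  have inj: "inj_on g V" using dist by (auto simp: V g_def inj_on_def)
  have sub: "?K \<subseteq> V" "?P \<subseteq> V" unfolding V by auto
  note image = complete_edges_image[OF inj_on_subset[OF inj sub(1)]]
    complete_edges_image[OF inj_on_subset[OF inj sub(2)]]
  have "g ` ?K = {0, 1, 2, 3}" "g ` ?P = {0, 1, 4, 5}" using dist by (auto simp: g_def)
  then have "(`) g ` E = edges H1"
    unfolding E image_Un image H1_def by simp
  moreover have "bij_betw g V (verts H1)"
    using inj gV by (simp add: bij_betw_def H1_def)
  ultimately show ?thesis unfolding isomorphic_def by auto
qed

end

context irreducible
begin

text \<open>The clique at \<open>p\<close> has one or two vertices outside the clique at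
  \<open>v\<close>: one gives \<open>K5_minus_e\<close>, two give \<open>H1\<close> with
  \<open>ab\<close> as the shared edge.\<close>

lemma exceptional: "isomorphic (V, E) K5_minus_e \<or> isomorphic (V, E) H1"
proof -
  obtain v p where vp: "v \<in> cubic" "p \<in> cubic" "p \<notin> nb v" "p \<noteq> v"
    and U: "insert v (nb v) \<union> insert p (nb p) = V"
    and le: "card (insert p (nb p) - insert v (nb v)) \<le> 2" by (rule two_cliques)
  let ?K = "insert v (nb v)" and ?P = "insert p (nb p)"
  have K: "clique ?K" and P: "clique ?P" using cubic_V(2) vp by blast+
  note Kc = cubic_clique[OF vp(1) K] and Pc = cubic_clique[OF vp(2) P]
  have vn: "v \<notin> nb p" using vp(3) nb_symD by metis
  show ?thesis
  proof (cases "nb p \<subseteq> nb v")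
    case True
    then have eq: "nb p = nb v"
      using vp by (intro card_subset_eq) (auto simp: cubic_def)
    obtain a b c where abc: "nb v = {a, b, c}" using cubic_nb[OF vp(1)] .
    have "isomorphic (V, E) K5_minus_e"
    proof (rule isomorphic_K5_minus_e[OF abc _ _ _ K])
      show "nb p = {a, b, c}" using eq abc by simp
      show "V = {v, p, a, b, c}" using U eq abc by auto
      show "distinct [v, p, a, b, c]"
        using cubic_distinct[OF vp(1) abc] cubic_distinct[OF vp(2), of a b c] eq abc vp(4) by auto
    qed
    then show ?thesis ..
  next
    case False
    then obtain q where q: "q \<in> nb p" "q \<notin> nb v" by auto
    have qv: "q \<noteq> v" using q(1) vn by auto
    obtain a b where ab: "nb p = {q, a, b}" "q \<noteq> a" "q \<noteq> b" "a \<noteq> b" using cubic_nb_of[OF vp(2) q(1)] .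
    have "w \<in> nb v" if "w \<in> nb p" "w \<noteq> q" for w
    proof (rule ccontr)
      assume "w \<notin> nb v"
      then have "{p, q, w} \<subseteq> ?P - ?K" using that q vn vp(3,4) qv by auto
      from card_mono[OF _ this] have "card {p, q, w} \<le> card (?P - ?K)" by simp
      moreover have "p \<noteq> q" "p \<noteq> w" using q(1) that nb_irrefl[of p] by auto
      ultimately show False using le that(2) by simp
    qed
    then have abv: "a \<in> nb v" "b \<in> nb v" using ab by auto
    obtain b' c where b'c: "nb v = {a, b', c}" "a \<noteq> b'" "a \<noteq> c" "b' \<noteq> c"
      using cubic_nb_of[OF vp(1) abv(1)] .
    have "\<exists>c. nb v = {a, b, c} \<and> a \<noteq> c \<and> b \<noteq> c"
    proof (cases "b = b'")
      case False
      then have "b = c" using abv(2) ab(4) b'c(1) by auto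
      then have "nb v = {a, b, b'}" using b'c(1) by auto
      then show ?thesis using b'c(2) False by blast
    qed (use b'c in blast)
    then obtain c where c: "nb v = {a, b, c}" "a \<noteq> c" "b \<noteq> c" by blast
    have "isomorphic (V, E) H1"
    proof (rule isomorphic_H1)
      show "V = {a, b, v, c, p, q}" using U c(1) ab(1) by auto
      show "distinct [a, b, v, c, p, q]"
        using cubic_distinct[OF vp(1) c(1)] cubic_distinct[OF vp(2) ab(1)] q qv vp(3,4) c(1) by auto
      have "?K = {a, b, v, c}" "?P = {a, b, p, q}" using c(1) ab(1) by auto
      then show "clique {a, b, v, c}" "clique {a, b, p, q}" using K P by simp_all
    qed
    then show ?thesis ..
  qed
qed

end

theorem theorem2p3:
  fixes G :: "'a graph"
  assumes "M22_circuit G"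
    and "\<not> isomorphic G K5_minus_e"
    and "\<not> isomorphic G H1"
  shows "(\<exists>H. K4_minus_reduction G H) \<or> (\<exists>M. admissible_edge_reduction G M)"
proof (rule ccontr)
  assume none: "\<not> ?thesis"
  obtain V E where G: "G = (V, E)" by (cases G)
  interpret irreducible V E
    by unfold_locales (use assms(1) none in \<open>auto simp: G\<close>)
  show False using exceptional assms(2,3) by (simp add: G)
qed

end
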